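(* Let $\rho\in\mathbb{N}$ (so $\rho\ge1$) and $p>0$. Let $\mathfrak{T}$ be the set of all typical functions in the Fréchet space $E_{\rho,p}$. Then there is a subset of $\mathfrak{T}$ which is a $G_\delta$ set in $E_{\rho,p}$ and is dense in $E_{\rho,p}$.
   Context: $E_{\rho,p}$ is the complex vector space of entire functions $f:\mathbb{C}\to\mathbb{C}$ with $\lim_{R\to\infty}\sup_{|z|\ge R}\frac{\ln|f(z)|}{|z|^\rho}\le p$, with the Fréchet topology generated by the norms $\|f\|_n=\sup_{z\in\mathbb{C}}\exp[-(p+1/n)|z|^\rho]\,|f(z)|$, $n\in\mathbb{N}$. An entire function $f$ is typical if it is surjective ($f(\mathbb{C})=\mathbb{C}$), has infinitely many critical points (zeros of $f'$), each critical point $z_0$ is non-degenerate ($f''(z_0)\ne0$), and the values of $f$ at distinct critical points are pairwise different. A $G_\delta$ set is a countable intersection of open sets. *)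

theory Defs
  imports "HOL-Analysis.Analysis"
begin

text \<open>Logarithm of a modulus, with the convention \<open>ln 0 = -\<infinity>\<close>
  (the library has \<open>ln 0 = 0\<close> on the reals).\<close>

definition ln_ext :: "real \<Rightarrow> ereal" where
  "ln_ext x = (if x = 0 then -\<infinity> else ereal (ln x))"

text \<open>The carrier of \<open>E\<^bsub>\<rho>,p\<^esub>\<close>. The supremum is taken in the extended reals and
  is antimonotone in \<open>R\<close>, so its limit always exists there.\<close>

definition E_space :: "nat \<Rightarrow> real \<Rightarrow> (complex \<Rightarrow> complex) set" where
  "E_space \<rho> p = {f. f holomorphic_on UNIV \<and>
     (\<exists>L. ((\<lambda>R::real. SUP z\<in>{z. norm z \<ge> R}. ln_ext (norm (f z)) / ereal (norm z ^ \<rho>))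
             \<longlongrightarrow> L) at_top \<and> L \<le> ereal p)}"

text \<open>The supremum is a supremum of reals; it is over a bounded set whenever
  \<open>f \<in> E_space \<rho> p\<close> and \<open>n \<ge> 1\<close>.\<close>

definition E_norm :: "nat \<Rightarrow> real \<Rightarrow> nat \<Rightarrow> (complex \<Rightarrow> complex) \<Rightarrow> real" where
  "E_norm \<rho> p n f = (SUP z. exp (- (p + 1 / real n) * norm z ^ \<rho>) * norm (f z))"

definition E_ball :: "nat \<Rightarrow> real \<Rightarrow> nat \<Rightarrow> (complex \<Rightarrow> complex) \<Rightarrow> real \<Rightarrow> (complex \<Rightarrow> complex) set" where
  "E_ball \<rho> p n f \<epsilon> = {g \<in> E_space \<rho> p. E_norm \<rho> p n (\<lambda>z. g z - f z) < \<epsilon>}"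

definition E_top :: "nat \<Rightarrow> real \<Rightarrow> (complex \<Rightarrow> complex) topology" where
  "E_top \<rho> p = topology_generated_by
     {E_ball \<rho> p n f \<epsilon> | n f \<epsilon>. n \<ge> 1 \<and> f \<in> E_space \<rho> p \<and> \<epsilon> > 0}"

lemma topspace_E_top: "topspace (E_top \<rho> p) = E_space \<rho> p"
proof
  show "topspace (E_top \<rho> p) \<subseteq> E_space \<rho> p"
    by (auto simp: E_top_def E_ball_def)
  show "E_space \<rho> p \<subseteq> topspace (E_top \<rho> p)"
  proof
    fix f assume f: "f \<in> E_space \<rho> p"
    then have "f \<in> E_ball \<rho> p 1 f 1"
      by (simp add: E_ball_def E_norm_def)
    with f show "f \<in> topspace (E_top \<rho> p)"
      unfolding E_top_def topology_generated_by_topspace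
      by (intro UnionI[of "E_ball \<rho> p 1 f 1"]) (blast intro: zero_less_one order_refl)+
  qed
qed

definition critical_points :: "(complex \<Rightarrow> complex) \<Rightarrow> complex set" where
  "critical_points f = {z. deriv f z = 0}"

definition typical :: "(complex \<Rightarrow> complex) \<Rightarrow> bool" where
  "typical f \<longleftrightarrow> f holomorphic_on UNIV \<and> surj f \<and>
     infinite (critical_points f) \<and>
     (\<forall>z\<in>critical_points f. deriv (deriv f) z \<noteq> 0) \<and>
     inj_on f (critical_points f)"

end

(* The four defining properties of a typical function, each tested on the disc of radius k
   (surjectivity: the disc is covered; infinitely many critical points: there is one outside the
   disc), cut out sets whose interiors are dense, and the Baire property of E_top then gives the
   result. Openness follows from locally uniform convergence of functions and their
   derivatives together with Hurwitz's theorem. For density, Taylor polynomials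
   are dense; a nonconstant polynomial is surjective, and adding c * z ^ (d + 1) to a polynomial P of
   degree d, with c chosen to make a far point w critical, costs only c = O(1 / |w|). To make f Morse
   on the disc, first add a small linear term, avoiding the countably many slopes for which some
   critical point degenerates, and then e * h, where h is a polynomial with h(z) = z and h'(z) = 0
   at the finitely many critical points z: for small e these stay the only critical points in the
   disc, while their values get separated. *)
theory Submission
  imports Defs "HOL-Complex_Analysis.Complex_Analysis"
begin

section \<open>Locally uniform convergence of entire functions\<close>

text \<open>Not all the disc conditions are open as they stand, so stability is proved only at
  well-chosen functions: nondegenerate ones for injectivity on the critical points, surjective ones
  for covering a disc, ones with nonconstant derivative for a far critical point. Each stability
  statement asserts only that a locally uniformly convergent sequence meets the condition once; by
  contraposition over shrinking balls this already yields an interior point. A polynomial of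
  positive degree has finitely many critical points and is never typical, yet it serves as an
  approximant, since a single disc asks for just one critical point beyond it. The conditions are
  gained one at a time by arbitrarily small changes, each made inside the open set already reached,
  so that a later change cannot spoil an earlier condition.\<close>

lemma uniform_limit_subseq:
  assumes "uniform_limit S g f sequentially" "strict_mono r"
  shows "uniform_limit S (\<lambda>j. g (r j)) f sequentially"
  using filterlim_compose[OF assms(1) filterlim_subseq[OF assms(2)]] .

lemma isCont_entire:
  fixes f :: "complex \<Rightarrow> complex"
  assumes "f holomorphic_on UNIV"
  shows "isCont f z"
  using holomorphic_on_imp_continuous_on[OF assms] by (simp add: continuous_on_eq_continuous_at)

lemma locally_uniform_tendsto:
  fixes f :: "complex \<Rightarrow> complex"
  assumes f: "f holomorphic_on UNIV"
    and lim: "\<And>R. uniform_limit (cball 0 R) g f sequentially" and a: "a \<longlonglongrightarrow> l"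
  shows "(\<lambda>j. g j (a j)) \<longlonglongrightarrow> f l"
proof -
  have fa: "(\<lambda>j. f (a j)) \<longlonglongrightarrow> f l"
    using isCont_tendsto_compose[OF isCont_entire[OF f] a] .
  have "\<forall>\<^sub>F j in sequentially. dist (a j) l < 1"
    using tendstoD[OF a, of 1] by simp
  then have ev: "\<forall>\<^sub>F j in sequentially. a j \<in> cball 0 (norm l + 1)"
  proof eventually_elim
    case (elim j)
    then show ?case using norm_triangle_ineq2[of "a j" l] by (simp add: dist_norm)
  qed
  have "(\<lambda>j. g j (a j) - f (a j)) \<longlonglongrightarrow> 0"
  proof (rule tendstoI)
    fix e :: real assume "e > 0"
    from uniform_limitD[OF lim this, of "norm l + 1"] ev
    show "\<forall>\<^sub>F j in sequentially. dist (g j (a j) - f (a j)) 0 < e"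
      by eventually_elim (auto simp: dist_norm)
  qed
  from tendsto_add[OF this fa] show ?thesis by simp
qed

text \<open>Cauchy's inequality on unit circles: closeness on the disc of radius
  \<open>R + 1\<close> passes to the derivatives on the disc of radius \<open>R\<close>. Halving
  \<open>e\<close> restores the strict inequality.\<close>

lemma locally_uniform_deriv:
  fixes f :: "complex \<Rightarrow> complex"
  assumes g: "\<And>j. g j holomorphic_on UNIV" and f: "f holomorphic_on UNIV"
    and lim: "\<And>R. uniform_limit (cball 0 R) g f sequentially"
  shows "uniform_limit (cball 0 R) (\<lambda>j. deriv (g j)) (deriv f) sequentially"
proof (rule uniform_limitI)
  fix e :: real assume e: "e > 0"
  then have "\<forall>\<^sub>F j in sequentially. \<forall>z\<in>cball 0 (R + 1). dist (g j z) (f z) < e / 2"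
    by (intro uniform_limitD[OF lim]) auto
  then show "\<forall>\<^sub>F j in sequentially. \<forall>z\<in>cball 0 R. dist (deriv (g j) z) (deriv f z) < e"
  proof eventually_elim
    case (elim j)
    show ?case
    proof
      fix z :: complex assume z: "z \<in> cball 0 R"
      have hol: "(\<lambda>z. g j z - f z) holomorphic_on A" for A
        by (intro holomorphic_intros holomorphic_on_subset[OF g] holomorphic_on_subset[OF f]) auto
      have "norm ((deriv ^^ 1) (\<lambda>z. g j z - f z) z) \<le> fact 1 * (e / 2) / 1 ^ 1"
      proof (rule Cauchy_inequality)
        fix x assume "norm (z - x) = 1"
        then have "x \<in> cball 0 (R + 1)"
          using z norm_triangle_ineq2[of x z] by (simp add: norm_minus_commute)
        with elim show "norm (g j x - f x) \<le> e / 2"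
          by (force simp: dist_norm)
      qed (use hol in \<open>auto intro: holomorphic_on_imp_continuous_on\<close>)
      moreover have "deriv (\<lambda>z. g j z - f z) z = deriv (g j) z - deriv f z"
        
        by (intro deriv_diff holomorphic_on_imp_differentiable_at[OF _ open_UNIV UNIV_I] g f)
      ultimately show "dist (deriv (g j) z) (deriv f z) < e"
        using e by (simp add: dist_norm)
    qed
  qed
qed

text \<open>Two distinct zeros of \<open>g j\<close> that merge in the limit: the mean value estimate for
  \<open>g j - deriv f l \<cdot> id\<close> between them forces \<open>deriv f l = 0\<close>.\<close>

lemma merging_zeros_deriv_zero:
  fixes f :: "complex \<Rightarrow> complex"
  assumes g: "\<And>j. g j holomorphic_on UNIV" and f: "f holomorphic_on UNIV"
    and lim: "\<And>R. uniform_limit (cball 0 R) g f sequentially"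
    and zeros: "\<And>j. g j (a j) = 0" "\<And>j. g j (b j) = 0" "\<And>j. a j \<noteq> b j"
    and ab: "a \<longlonglongrightarrow> l" "b \<longlonglongrightarrow> l"
  shows "deriv f l = 0"
proof (rule ccontr)
  assume "deriv f l \<noteq> 0"
  \<comment> \<open>With a third, the two approximation errors add up to \<open>2 * e\<close>,
    strictly below \<open>norm (deriv f l) = 3 * e\<close>.\<close>
  define e where "e = norm (deriv f l) / 3"
  have e: "e > 0" using \<open>deriv f l \<noteq> 0\<close> by (simp add: e_def)
  have "isCont (deriv f) l"
    using f by (intro isCont_entire holomorphic_deriv) auto
  then obtain \<delta> where \<delta>: "\<delta> > 0" "\<And>z. dist z l < \<delta> \<Longrightarrow> dist (deriv f z) (deriv f l) < e"
    using e by (auto simp: continuous_at_eps_delta)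
  have "\<forall>\<^sub>F j in sequentially. \<forall>z\<in>cball 0 (norm l + \<delta>). dist (deriv (g j) z) (deriv f z) < e"
    using e by (intro uniform_limitD locally_uniform_deriv g f lim)
  moreover have "\<forall>\<^sub>F j in sequentially. dist (a j) l < \<delta>" "\<forall>\<^sub>F j in sequentially. dist (b j) l < \<delta>"
    using ab \<delta>(1) by (auto intro: tendstoD)
  ultimately have "\<forall>\<^sub>F j in sequentially. False"
  proof eventually_elim
    case (elim j)
    have "norm ((g j (a j) - deriv f l * a j) - (g j (b j) - deriv f l * b j)) \<le> (2 * e) * norm (a j - b j)"
    proof (rule field_differentiable_bound[where S = "ball l \<delta>" and f' = "\<lambda>z. deriv (g j) z - deriv f l"])
      show "((\<lambda>z. g j z - deriv f l * z) has_field_derivative deriv (g j) z - deriv f l) (at z within ball l \<delta>)" for z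
        using holomorphic_derivI[OF g, of z]
        by (auto intro!: derivative_eq_intros intro: has_field_derivative_at_within)
      fix z assume z: "z \<in> ball l \<delta>"
      then have "z \<in> cball 0 (norm l + \<delta>)"
        using norm_triangle_ineq2[of z l] by (auto simp: dist_norm norm_minus_commute)
      with elim(1) have "norm (deriv (g j) z - deriv f z) < e" by (auto simp: dist_norm)
      moreover have "norm (deriv f z - deriv f l) < e"
        using \<delta>(2)[of z] z by (auto simp: dist_norm norm_minus_commute)
      ultimately show "norm (deriv (g j) z - deriv f l) \<le> 2 * e"
        using norm_triangle_ineq[of "deriv (g j) z - deriv f z" "deriv f z - deriv f l"] by simp
    qed (use elim in \<open>auto simp: dist_commute\<close>)
    also have "(g j (a j) - deriv f l * a j) - (g j (b j) - deriv f l * b j) = - deriv f l * (a j - b j)"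
      by (simp add: zeros algebra_simps)
    finally have "3 * e * norm (a j - b j) \<le> 2 * e * norm (a j - b j)"
      by (simp add: norm_mult e_def)
    with e zeros(3)[of j] show False by simp
  qed
  then show False by simp
qed

text \<open>If no \<open>g j\<close> vanished near \<open>z0\<close>, Hurwitz would make
  \<open>f\<close> zero-free there, since nonconstancy on the plane passes to the ball by the
  identity theorem. A single \<open>j\<close> suffices for the interior criterion
  \<open>in_interior_sequentially\<close>.\<close>

lemma hurwitz_ex_zero:
  fixes f :: "complex \<Rightarrow> complex"
  assumes g: "\<And>j::nat. g j holomorphic_on UNIV" and f: "f holomorphic_on UNIV"
    and lim: "\<And>R. uniform_limit (cball 0 R) g f sequentially"
    and nonconst: "\<not> f constant_on UNIV" and "f z0 = 0" "r > 0"
  shows "\<exists>j. \<exists>z\<in>ball z0 r. g j z = 0"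
proof (rule ccontr)
  assume *: "\<not> (\<exists>j. \<exists>z\<in>ball z0 r. g j z = 0)"
  have "f z0 \<noteq> 0"
  proof (rule Hurwitz_no_zeros[of "ball z0 r" g f])
    show "uniform_limit K g f sequentially" if K: "compact K" for K
    proof -
      obtain R where "\<And>z. z \<in> K \<Longrightarrow> norm z \<le> R"
        using compact_imp_bounded[OF K] by (auto simp: bounded_iff)
      then show ?thesis by (intro uniform_limit_on_subset[OF lim[of R]]) auto
    qed
    show "\<not> f constant_on ball z0 r"
    proof
      assume "f constant_on ball z0 r"
      then have 0: "f z = 0" if "z \<in> ball z0 r" for z
        using \<open>f z0 = 0\<close> \<open>r > 0\<close> that by (metis centre_in_ball constant_on_def)
      have "f z = 0" for z
        using \<open>r > 0\<close> by (rule_tac analytic_continuation[OF f, of "ball z0 r" z0]) (auto simp: islimpt_ball 0)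
      with nonconst show False by (auto simp: constant_on_def)
    qed
    show "g j holomorphic_on ball z0 r" for j using g holomorphic_on_subset by blast
    show "f holomorphic_on ball z0 r" using f holomorphic_on_subset by blast
  qed (use * \<open>r > 0\<close> in auto)
  with \<open>f z0 = 0\<close> show False by simp
qed

section \<open>Stability of the disc conditions under locally uniform convergence\<close>

lemma compact_cball_subseq:
  fixes z :: "nat \<Rightarrow> complex"
  assumes "\<And>j. z j \<in> cball 0 k"
  obtains l r where "l \<in> cball 0 k" "strict_mono r" "(\<lambda>j. z (r j)) \<longlonglongrightarrow> l"
proof -
  have "\<exists>l\<in>cball 0 k. \<exists>r. strict_mono r \<and> (z \<circ> r) \<longlonglongrightarrow> l"
    using compact_cball[of "0::complex" k] assms unfolding compact_def by blast
  then show thesis using that by (auto simp: comp_def)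
qed

lemma deriv_entire:
  "f holomorphic_on UNIV \<Longrightarrow> deriv f holomorphic_on UNIV"
  by (simp add: holomorphic_deriv)

lemma critical_points_converge:
  fixes f :: "complex \<Rightarrow> complex"
  assumes g: "\<And>j. g j holomorphic_on UNIV" and f: "f holomorphic_on UNIV"
    and lim: "\<And>R. uniform_limit (cball 0 R) g f sequentially"
    and z: "\<And>j. deriv (g j) (z j) = 0" "z \<longlonglongrightarrow> l"
  shows "deriv f l = 0"
  using locally_uniform_tendsto[OF deriv_entire[OF f] locally_uniform_deriv[OF g f lim] z(2)] z(1)
  by (simp add: LIMSEQ_const_iff)

text \<open>Degenerate critical points of the \<open>g j\<close> in the compact disc would
  accumulate at a degenerate critical point of \<open>f\<close>.\<close>

lemma nondegenerate_stable:
  fixes f :: "complex \<Rightarrow> complex"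
  assumes g: "\<And>j. g j holomorphic_on UNIV" and f: "f holomorphic_on UNIV"
    and lim: "\<And>R. uniform_limit (cball 0 R) g f sequentially"
    and nd: "\<forall>z\<in>cball 0 k. deriv f z = 0 \<longrightarrow> deriv (deriv f) z \<noteq> 0"
  shows "\<exists>j. \<forall>z\<in>cball 0 k. deriv (g j) z = 0 \<longrightarrow> deriv (deriv (g j)) z \<noteq> 0"
proof (rule ccontr)
  assume "\<not> ?thesis"
  then obtain z where z: "\<And>j. z j \<in> cball 0 k" "\<And>j. deriv (g j) (z j) = 0"
      "\<And>j. deriv (deriv (g j)) (z j) = 0"
    by metis
  obtain l r where l: "l \<in> cball 0 k" "strict_mono r" "(\<lambda>j. z (r j)) \<longlonglongrightarrow> l"
    using compact_cball_subseq z(1) .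
  have "deriv f l = 0"
    using critical_points_converge[OF g f uniform_limit_subseq[OF lim l(2)] z(2) l(3)] .
  moreover have "deriv (deriv f) l = 0"
    using critical_points_converge[OF deriv_entire[OF g] deriv_entire[OF f]
        uniform_limit_subseq[OF locally_uniform_deriv[OF g f lim] l(2)] z(3) l(3)] .
  ultimately show False using nd l(1) by blast
qed

text \<open>Colliding critical points \<open>a j\<close>, \<open>b j\<close> have limits
  \<open>l\<close>, \<open>m\<close> with \<open>f l = f m\<close>, hence \<open>l = m\<close> by
  injectivity; but then two zeros of \<open>deriv (g j)\<close> merge at \<open>l\<close> and make
  it degenerate. Nondegeneracy is what keeps one critical point from splitting into several with a
  common value.\<close>

lemma critical_values_inj_stable:
  fixes f :: "complex \<Rightarrow> complex"
  assumes g: "\<And>j. g j holomorphic_on UNIV" and f: "f holomorphic_on UNIV"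
    and lim: "\<And>R. uniform_limit (cball 0 R) g f sequentially"
    and nd: "\<forall>z\<in>cball 0 k. deriv f z = 0 \<longrightarrow> deriv (deriv f) z \<noteq> 0"
    and inj: "inj_on f {z\<in>cball 0 k. deriv f z = 0}"
  shows "\<exists>j. inj_on (g j) {z\<in>cball 0 k. deriv (g j) z = 0}"
proof (rule ccontr)
  assume "\<not> ?thesis"
  then have "\<forall>j. \<exists>a b. a \<in> cball 0 k \<and> b \<in> cball 0 k \<and> deriv (g j) a = 0 \<and> deriv (g j) b = 0
      \<and> g j a = g j b \<and> a \<noteq> b"
    by (simp add: inj_on_def) blast
  then obtain a b where ab: "\<And>j. a j \<in> cball 0 k" "\<And>j. b j \<in> cball 0 k"
      "\<And>j. deriv (g j) (a j) = 0" "\<And>j. deriv (g j) (b j) = 0"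
      "\<And>j. g j (a j) = g j (b j)" "\<And>j. a j \<noteq> b j"
    by metis
  obtain l r where l: "l \<in> cball 0 k" "strict_mono r" "(\<lambda>j. a (r j)) \<longlonglongrightarrow> l"
    using compact_cball_subseq ab(1) .
  obtain m s where m: "m \<in> cball 0 k" "strict_mono s" "(\<lambda>j. b (r (s j))) \<longlonglongrightarrow> m"
    using compact_cball_subseq[of "\<lambda>j. b (r j)"] ab(2) by blast
  have rs: "strict_mono (\<lambda>j. r (s j))" using l(2) m(2) by (simp add: strict_mono_def)
  note lim' = uniform_limit_subseq[OF lim rs]
  have al: "(\<lambda>j. a (r (s j))) \<longlonglongrightarrow> l"
    using LIMSEQ_subseq_LIMSEQ[OF l(3) m(2)] by (simp add: comp_def)
  have "deriv f l = 0" using critical_points_converge[OF g f lim' ab(3) al] .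
  moreover have "deriv f m = 0" using critical_points_converge[OF g f lim' ab(4) m(3)] .
  moreover have "f l = f m"
    using locally_uniform_tendsto[OF f lim' al] locally_uniform_tendsto[OF f lim' m(3)] ab(5)
    by (simp add: LIMSEQ_unique)
  ultimately have "l = m" using inj l(1) m(1) by (auto simp: inj_on_def)
  then have "deriv (deriv f) l = 0"
    using al m(3) ab
    by (intro merging_zeros_deriv_zero[OF deriv_entire[OF g] deriv_entire[OF f]
        uniform_limit_subseq[OF locally_uniform_deriv[OF g f lim] rs],
        of "\<lambda>j. a (r (s j))" "\<lambda>j. b (r (s j))"]) auto
  with nd \<open>deriv f l = 0\<close> l(1) show False by blast
qed

text \<open>Values \<open>c j\<close> missed by \<open>g j\<close> accumulate at some
  \<open>l\<close>, which \<open>f\<close> attains; Hurwitz applied to \<open>g j - c j\<close>,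
  tending to \<open>f - l\<close> along a subsequence, then produces a preimage of some
  \<open>c j\<close>.\<close>

lemma covers_cball_stable:
  fixes f :: "complex \<Rightarrow> complex"
  assumes g: "\<And>j. g j holomorphic_on UNIV" and f: "f holomorphic_on UNIV"
    and lim: "\<And>R. uniform_limit (cball 0 R) g f sequentially" and "surj f"
  shows "\<exists>j. cball 0 k \<subseteq> range (g j)"
proof (rule ccontr)
  assume "\<not> ?thesis"
  then have "\<forall>j. \<exists>c. c \<in> cball 0 k \<and> c \<notin> range (g j)" by blast
  then obtain c where c: "\<And>j. c j \<in> cball 0 k" "\<And>j. c j \<notin> range (g j)"
    by metis
  obtain l r where l: "strict_mono r" "(\<lambda>j. c (r j)) \<longlonglongrightarrow> l"
    using compact_cball_subseq c(1) .
  obtain z0 where z0: "f z0 = l" using \<open>surj f\<close> by (metis surjD)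
  have "\<exists>j. \<exists>z\<in>ball z0 1. g (r j) z - c (r j) = 0"
  proof (rule hurwitz_ex_zero)
    show "uniform_limit (cball 0 R) (\<lambda>j z. g (r j) z - c (r j)) (\<lambda>z. f z - l) sequentially" for R
    proof (intro uniform_limit_intros uniform_limit_subseq[OF lim l(1)])
      show "uniform_limit (cball 0 R) (\<lambda>j z. c (r j)) (\<lambda>z. l) sequentially"
      proof (rule uniform_limitI)
        fix e :: real assume "e > 0"
        from tendstoD[OF l(2) this]
        show "\<forall>\<^sub>F j in sequentially. \<forall>z\<in>cball 0 R. dist (c (r j)) l < e"
          by eventually_elim auto
      qed
    qed
    show "\<not> (\<lambda>z. f z - l) constant_on UNIV"
    proof
      assume "(\<lambda>z. f z - l) constant_on UNIV"
      then obtain d where "\<And>z. f z - l = d" by (auto simp: constant_on_def)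
      then have "f z = d + l" for z by (metis diff_add_cancel)
      with \<open>surj f\<close> have "(d + l + 1) = d + l" by (metis surjD)
      then show False by simp
    qed
  qed (use g f z0 in \<open>auto intro!: holomorphic_intros\<close>)
  then show False using c(2) by (metis diff_eq_diff_eq diff_self rangeI right_minus_eq)
qed

lemma far_critical_point_stable:
  fixes f :: "complex \<Rightarrow> complex"
  assumes g: "\<And>j. g j holomorphic_on UNIV" and f: "f holomorphic_on UNIV"
    and lim: "\<And>R. uniform_limit (cball 0 R) g f sequentially"
    and nonconst: "\<not> deriv f constant_on UNIV" and w: "deriv f w = 0" "norm w > k"
  shows "\<exists>j z. norm z > k \<and> deriv (g j) z = 0"
proof -
  \<comment> \<open>The radius \<open>norm w - k\<close> keeps the ball around \<open>w\<close>
    outside the closed disc of radius \<open>k\<close>.\<close>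
  have "\<exists>j. \<exists>z\<in>ball w (norm w - k). deriv (g j) z = 0"
    using w nonconst
    by (intro hurwitz_ex_zero[OF deriv_entire[OF g] deriv_entire[OF f] locally_uniform_deriv[OF g f lim]]) auto
  then obtain j z where z: "z \<in> ball w (norm w - k)" "deriv (g j) z = 0" by blast
  then have "norm z > k" using norm_triangle_ineq2[of w z] by (simp add: dist_norm)
  with z(2) show ?thesis by blast
qed

section \<open>Complex polynomials: interpolation and surjectivity\<close>

lemma hermite_interpolation:
  fixes a b :: "complex \<Rightarrow> complex"
  assumes "finite S"
  shows "\<exists>P. \<forall>z\<in>S. poly P z = a z \<and> poly (pderiv P) z = b z"
  using assms
proof (induction S)
  case empty
  then show ?case by simp
next
  case (insert w S)
  then obtain P where P: "\<And>z. z \<in> S \<Longrightarrow> poly P z = a z \<and> poly (pderiv P) z = b z" by blast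
  \<comment> \<open>\<open>Q = q * q\<close> vanishes to second order on \<open>S\<close>, so
    multiples of \<open>Q\<close> and \<open>Q * L\<close> leave the data on \<open>S\<close>
    intact; \<open>c\<close> corrects the value at \<open>w\<close>, and \<open>d\<close> the slope,
    because the derivative of \<open>Q * L\<close> at \<open>w\<close> is \<open>poly Q w\<close>,
    nonzero as \<open>w \<notin> S\<close>.\<close>
  define q where "q = (\<Prod>s\<in>S. [:- s, 1:])"
  define Q where "Q = q * q"
  have q0: "poly q z = 0" if "z \<in> S" for z
    using insert.hyps(1) that by (simp add: q_def poly_prod)
  have Q0: "poly Q z = 0" "poly (pderiv Q) z = 0" if "z \<in> S" for z
    using q0[OF that] by (auto simp: Q_def pderiv_mult)
  have Qw: "poly Q w \<noteq> 0"
    using insert.hyps by (auto simp: Q_def q_def poly_prod)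
  define c where "c = (a w - poly P w) / poly Q w"
  define d where "d = (b w - poly (pderiv P) w - c * poly (pderiv Q) w) / poly Q w"
  define L where "L = [:- w, 1:]"
  have L: "poly L z = z - w" "pderiv L = 1" for z
    by (simp_all add: L_def pderiv_pCons one_pCons)
  define P' where "P' = P + smult c Q + smult d (Q * L)"
  have *: "poly P' z = poly P z + c * poly Q z + d * (poly Q z * (z - w))"
    "poly (pderiv P') z = poly (pderiv P) z + c * poly (pderiv Q) z
       + d * (poly Q z + poly (pderiv Q) z * (z - w))" for z
    by (simp_all add: P'_def pderiv_add pderiv_smult pderiv_mult L algebra_simps)
  have "poly P' z = a z \<and> poly (pderiv P') z = b z" if "z \<in> insert w S" for z
  proof (cases "z = w")
    case True
    show ?thesis unfolding * True using Qw by (simp add: c_def d_def)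
  next
    case False
    then show ?thesis unfolding * using P Q0 that by auto
  qed
  then show ?case by blast
qed

lemma surj_poly:
  fixes P :: "complex poly"
  assumes "degree P > 0"
  shows "surj (poly P)"
proof -
  have "\<exists>z. poly P z = c" for c
  proof -
    define Q where "Q = P - [:c:]"
    have deg: "degree Q > 0"
      using assms degree_add_eq_left[of "- [:c:]" P] by (simp add: Q_def del: minus_pCons)
    then have "\<exists>i\<in>{1..degree Q}. coeff Q i \<noteq> 0"
      by (intro bexI[of _ "degree Q"]) auto
    then obtain z where "(\<Sum>i\<le>degree Q. coeff Q i * z ^ i) = 0"
      using fundamental_theorem_of_algebra[of "coeff Q" "degree Q"] by blast
    then have "poly Q z = 0" by (simp add: poly_altdef)
    then have "poly P z = c" by (simp add: Q_def)
    then show ?thesis ..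
  qed
  then show ?thesis unfolding surj_def by metis
qed

lemma not_constant_poly:
  fixes P :: "complex poly"
  assumes "degree P > 0"
  shows "\<not> poly P constant_on UNIV"
proof
  assume "poly P constant_on UNIV"
  then obtain c where c: "\<And>z. poly P z = c" by (auto simp: constant_on_def)
  have "\<exists>z. poly P z = c + 1" using surj_poly[OF assms] by (metis surjD)
  with c show False by simp
qed

lemma deriv_poly: "deriv (poly (P :: complex poly)) = poly (pderiv P)"
  by (rule ext) (simp add: DERIV_imp_deriv poly_DERIV)

text \<open>New critical points \<open>z j\<close> would tend, along a subsequence, to a critical
  point \<open>l\<close> of \<open>f\<close>. As \<open>l\<close> persists as a critical point of
  every \<open>g j\<close>, the zeros \<open>z j\<close> and \<open>l\<close> of
  \<open>deriv (g j)\<close> merge, and \<open>l\<close> would be degenerate.\<close>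

lemma no_new_critical_points:
  fixes f :: "complex \<Rightarrow> complex"
  assumes g: "\<And>j. g j holomorphic_on UNIV" and f: "f holomorphic_on UNIV"
    and lim: "\<And>R. uniform_limit (cball 0 R) g f sequentially"
    and nd: "\<forall>z\<in>cball 0 k. deriv f z = 0 \<longrightarrow> deriv (deriv f) z \<noteq> 0"
    and old: "\<And>j z. z \<in> cball 0 k \<Longrightarrow> deriv f z = 0 \<Longrightarrow> deriv (g j) z = 0"
  shows "\<exists>j. \<forall>z\<in>cball 0 k. deriv (g j) z = 0 \<longrightarrow> deriv f z = 0"
proof (rule ccontr)
  assume "\<not> ?thesis"
  then obtain z where z: "\<And>j. z j \<in> cball 0 k" "\<And>j. deriv (g j) (z j) = 0"
      "\<And>j. deriv f (z j) \<noteq> 0"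
    by metis
  obtain l r where l: "l \<in> cball 0 k" "strict_mono r" "(\<lambda>j. z (r j)) \<longlonglongrightarrow> l"
    using compact_cball_subseq z(1) .
  have l0: "deriv f l = 0"
    using critical_points_converge[OF g f uniform_limit_subseq[OF lim l(2)] z(2) l(3)] .
  have "deriv (deriv f) l = 0"
  proof (rule merging_zeros_deriv_zero)
    show "(\<lambda>j. z (r j)) \<longlonglongrightarrow> l" by (rule l(3))
    show "uniform_limit (cball 0 R) (\<lambda>j. deriv (g (r j))) (deriv f) sequentially" for R
      by (rule uniform_limit_subseq[OF locally_uniform_deriv[OF g f lim] l(2)])
    show "z (r j) \<noteq> l" for j using z(3) l0 by metis
    show "deriv (g (r j)) l = 0" for j using old l(1) l0 by blast
  qed (use g f z(2) in \<open>auto intro: deriv_entire\<close>)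
  with nd l(1) l0 show False by blast
qed

section \<open>Zeros of derivatives and decay of polynomial quotients\<close>

lemma entire_deriv_zero_imp_constant:
  fixes f :: "complex \<Rightarrow> complex"
  assumes f: "f holomorphic_on UNIV" and "\<And>z. deriv f z = 0"
  shows "f z = f 0"
proof -
  have "(f has_field_derivative 0) (at z within UNIV)" for z
    using holomorphic_derivI[OF f, of z] assms(2) by simp
  then obtain c where "\<And>z. f z = c"
    using has_field_derivative_zero_constant[of UNIV f] by auto
  then show ?thesis by simp
qed

lemma poly_over_power_tendsto_0:
  fixes R :: "complex poly"
  assumes "degree R < d"
  shows "((\<lambda>w. poly R w / w ^ d) \<longlongrightarrow> 0) at_infinity"
proof -
  have "((\<lambda>w. \<Sum>i\<le>degree R. coeff R i * inverse w ^ (d - i)) \<longlongrightarrow>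
      (\<Sum>i\<le>degree R. coeff R i * 0 ^ (d - i))) at_infinity"
    by (intro tendsto_intros tendsto_inverse_0)
  also have "(\<Sum>i\<le>degree R. coeff R i * 0 ^ (d - i)) = 0"
    using assms by (intro sum.neutral) (auto simp: power_0_left)
  finally have lim: "((\<lambda>w. \<Sum>i\<le>degree R. coeff R i * inverse w ^ (d - i)) \<longlongrightarrow> 0) at_infinity" .
  have "\<forall>\<^sub>F w::complex in at_infinity. w \<noteq> 0"
    by (auto simp: eventually_at_infinity intro!: exI[of _ 1])
  then have "\<forall>\<^sub>F w in at_infinity. (\<Sum>i\<le>degree R. coeff R i * inverse w ^ (d - i)) = poly R w / w ^ d"
  proof eventually_elim
    case (elim w)
    have "coeff R i * inverse w ^ (d - i) = coeff R i * w ^ i / w ^ d" if "i \<le> degree R" for i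
      using that assms elim by (simp add: power_diff power_inverse field_simps)
    then show ?case by (simp add: poly_altdef sum_divide_distrib)
  qed
  from Lim_transform_eventually[OF lim this] show ?thesis .
qed

text \<open>Adding \<open>c * z\<close> shifts \<open>deriv f\<close> by \<open>c\<close> and keeps
  the second derivative, so a degenerate critical point appears exactly when \<open>- c\<close> lies
  in this set. Countability survives even when \<open>deriv (deriv f)\<close> vanishes identically,
  since \<open>deriv f\<close> is then constant.\<close>

lemma countable_degenerate_slopes:
  fixes f :: "complex \<Rightarrow> complex"
  assumes f: "f holomorphic_on UNIV"
  shows "countable (deriv f ` {z. deriv (deriv f) z = 0})"
proof (cases "deriv (deriv f) constant_on UNIV")
  case False
  then have "countable {z\<in>UNIV. deriv (deriv f) z = 0}"
    using f by (intro holomorphic_countable_zeros deriv_entire) auto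
  then show ?thesis by simp
next
  case True
  then obtain c where c: "\<And>z. deriv (deriv f) z = c" by (auto simp: constant_on_def)
  show ?thesis
  proof (cases "c = 0")
    case True
    then have "deriv f z = deriv f 0" for z
      using entire_deriv_zero_imp_constant[OF deriv_entire[OF f]] c by blast
    then have "deriv f ` {z. deriv (deriv f) z = 0} \<subseteq> {deriv f 0}" by blast
    then show ?thesis by (rule countable_subset) simp
  qed (simp add: c)
qed

lemma finite_critical_points_cball:
  fixes f :: "complex \<Rightarrow> complex"
  assumes f: "f holomorphic_on UNIV"
    and nd: "\<And>z. deriv f z = 0 \<Longrightarrow> deriv (deriv f) z \<noteq> 0"
  shows "finite {z\<in>cball 0 k. deriv f z = 0}"
proof (cases "deriv f constant_on UNIV")
  case False
  then show ?thesis
    using f by (intro holomorphic_compact_finite_zeros[of _ UNIV] deriv_entire) auto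
next
  case True
  then obtain c where "deriv f = (\<lambda>z. c)" by (auto simp: constant_on_def)
  then have "deriv (deriv f) z = 0" for z by simp
  with nd have "{z\<in>cball 0 k. deriv f z = 0} = {}" by blast
  then show ?thesis by (metis finite.emptyI)
qed

section \<open>The growth spaces\<close>

text \<open>The suprema in the definition of \<open>E_space\<close> decrease in \<open>R\<close>, so
  their limit exists and is the infimum; membership reduces to bounding that infimum.\<close>

lemma tendsto_INF_antimono_at_top:
  fixes S :: "real \<Rightarrow> ereal"
  assumes "antimono S"
  shows "(S \<longlongrightarrow> (INF R. S R)) at_top"
proof (rule order_tendstoI)
  fix a assume "a < (INF R. S R)"
  then show "\<forall>\<^sub>F R in at_top. a < S R"
    by (metis (mono_tags, lifting) INF_lower UNIV_I eventuallyI less_le_trans)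
next
  fix a assume "(INF R. S R) < a"
  then obtain R where "S R < a"
    by (auto simp: INF_less_iff)
  then have "S R' < a" if "R' \<ge> R" for R'
    using antimonoD[OF assms that] by (rule le_less_trans[rotated])
  then show "\<forall>\<^sub>F R in at_top. S R < a"
    by (auto simp: eventually_at_top_linorder)
qed

text \<open>Turns the logarithmic growth quotient into an exponential bound; the value
  \<open>-\<infinity>\<close> of \<open>ln_ext\<close> at 0 makes this valid at zeros of the
  function too.\<close>

lemma ln_ext_divide_le_iff:
  assumes "s > 0" "x \<ge> 0"
  shows "ln_ext x / ereal s \<le> ereal q \<longleftrightarrow> x \<le> exp (q * s)"
proof (cases "x = 0")
  case True
  then show ?thesis using assms by (simp add: ln_ext_def divide_ereal_def)
next
  case False
  with assms have "x > 0" by simp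
  have "ln_ext x / ereal s \<le> ereal q \<longleftrightarrow> ln x / s \<le> q"
    using False assms by (simp add: ln_ext_def)
  also have "\<dots> \<longleftrightarrow> ln x \<le> q * s"
    using assms by (simp add: pos_divide_le_eq)
  also have "\<dots> \<longleftrightarrow> x \<le> exp (q * s)"
    using \<open>x > 0\<close> by (metis exp_ln exp_le_cancel_iff)
  finally show ?thesis .
qed

lemma power_div_fact_le_exp:
  fixes x :: real
  assumes "x \<ge> 0"
  shows "x ^ n / fact n \<le> exp x"
proof -
  have "(\<Sum>k\<in>{n}. x ^ k /\<^sub>R fact k) \<le> (\<Sum>k. x ^ k /\<^sub>R fact k)"
    using assms by (intro sum_le_suminf summable_exp_generic) auto
  then show ?thesis by (simp add: exp_def divide_inverse mult.commute)
qed

section \<open>Exponential bounds and the linear structure of the space\<close>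

locale typical_growth =
  fixes \<rho> :: nat and p :: real
  assumes rho: "\<rho> \<ge> 1" and p: "p > 0"
begin

lemma norm_power_rho_ge:
  assumes "1 \<le> R" "R \<le> norm (z::complex)"
  shows "R \<le> norm z ^ \<rho>"
proof -
  have "norm z ^ 1 \<le> norm z ^ \<rho>"
    using assms rho by (intro power_increasing) auto
  with assms show ?thesis by simp
qed

text \<open>With its converse \<open>E_spaceI_bound\<close>, this replaces the limit in the
  definition by one bound for each \<open>q > p\<close>, the form in which growth is handled from
  here on.\<close>

lemma E_spaceD_bound:
  assumes f: "f \<in> E_space \<rho> p" and q: "q > p"
  shows "\<exists>C\<ge>0. \<forall>z. norm (f z) \<le> C * exp (q * norm z ^ \<rho>)"
proof -
  let ?S = "\<lambda>R::real. SUP z\<in>{z. norm z \<ge> R}. ln_ext (norm (f z)) / ereal (norm z ^ \<rho>)"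
  from f obtain L where hol: "f holomorphic_on UNIV" and L: "(?S \<longlongrightarrow> L) at_top" "L \<le> ereal p"
    by (auto simp: E_space_def)
  from L(2) q have "L < ereal q"
    by (meson le_less_trans less_ereal.simps(1))
  from order_tendstoD(2)[OF L(1) this] obtain R0 where R0: "\<And>R. R \<ge> R0 \<Longrightarrow> ?S R < ereal q"
    by (auto simp: eventually_at_top_linorder)
  define R where "R = max 1 R0"
  have far: "norm (f z) \<le> exp (q * norm z ^ \<rho>)" if "norm z \<ge> R" for z
  proof -
    have "ln_ext (norm (f z)) / ereal (norm z ^ \<rho>) \<le> ?S R"
      using that by (intro SUP_upper) auto
    also have "\<dots> \<le> ereal q" using R0[of R] by (simp add: R_def)
    finally have "ln_ext (norm (f z)) / ereal (norm z ^ \<rho>) \<le> ereal q" .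
    moreover have "norm z ^ \<rho> > 0"
      using that by (intro zero_less_power) (auto simp: R_def)
    ultimately show ?thesis by (simp add: ln_ext_divide_le_iff)
  qed
  have "compact (f ` cball 0 R)"
    using hol by (intro compact_continuous_image holomorphic_on_imp_continuous_on)
      (auto intro: holomorphic_on_subset)
  then obtain B where B: "\<And>z. z \<in> cball 0 R \<Longrightarrow> norm (f z) \<le> B"
    by (metis compact_imp_bounded bounded_iff imageI)
  have "norm (f z) \<le> max 1 B * exp (q * norm z ^ \<rho>)" for z
  proof (cases "norm z \<ge> R")
    case True
    have "exp (q * norm z ^ \<rho>) \<le> max 1 B * exp (q * norm z ^ \<rho>)" by simp
    with far[OF True] show ?thesis by linarith
  next
    case False
    have "1 \<le> exp (q * norm z ^ \<rho>)" using p q by simp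
    then have "max 1 B * 1 \<le> max 1 B * exp (q * norm z ^ \<rho>)"
      by (intro mult_left_mono) auto
    moreover have "norm (f z) \<le> B" using B[of z] False by simp
    ultimately show ?thesis by linarith
  qed
  then show ?thesis by (intro exI[of _ "max 1 B"]) auto
qed

lemma E_spaceI_bound:
  assumes hol: "f holomorphic_on UNIV"
    and bd: "\<And>q. q > p \<Longrightarrow> \<exists>C. \<forall>z. norm (f z) \<le> C * exp (q * norm z ^ \<rho>)"
  shows "f \<in> E_space \<rho> p"
proof -
  define S where "S = (\<lambda>R::real. SUP z\<in>{z. norm z \<ge> R}. ln_ext (norm (f z)) / ereal (norm z ^ \<rho>))"
  have "antimono S"
    unfolding S_def by (intro antimonoI SUP_subset_mono) auto
  have "(INF R. S R) \<le> ereal p"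
  proof (rule ereal_le_epsilon2)
    fix e :: real assume e: "e > 0"
    obtain C where C: "\<And>z. norm (f z) \<le> C * exp ((p + e/2) * norm z ^ \<rho>)"
      using bd[of "p + e/2"] e by auto
    \<comment> \<open>Half of \<open>e\<close> raises the exponent from \<open>p\<close> to
      \<open>p + e/2\<close>; the other half absorbs the constant \<open>C\<close>, and
      \<open>R\<close> is chosen so that \<open>exp (e / 2 * norm z ^ \<rho>)\<close> dominates it
      from this radius on.\<close>
    define R where "R = max 1 (2 * ln (max 1 C) / e)"
    have "S R \<le> ereal (p + e)"
      unfolding S_def
    proof (rule SUP_least)
      fix z assume "z \<in> {z::complex. norm z \<ge> R}"
      then have z: "R \<le> norm z ^ \<rho>" "norm z > 0"
        using norm_power_rho_ge[of R z] by (auto simp: R_def)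
      have "2 * ln (max 1 C) / e \<le> norm z ^ \<rho>" using z by (simp add: R_def)
      then have "ln (max 1 C) \<le> e / 2 * norm z ^ \<rho>"
        using e by (simp add: field_simps)
      then have "max 1 C \<le> exp (e / 2 * norm z ^ \<rho>)"
        by (metis exp_ln exp_le_cancel_iff less_max_iff_disj zero_less_one)
      have "norm (f z) \<le> max 1 C * exp ((p + e/2) * norm z ^ \<rho>)"
        using C[of z] by (rule order_trans) (simp add: mult_right_mono)
      also have "\<dots> \<le> exp (e / 2 * norm z ^ \<rho>) * exp ((p + e/2) * norm z ^ \<rho>)"
        using \<open>max 1 C \<le> _\<close> by (intro mult_right_mono) auto
      also have "\<dots> = exp ((p + e) * norm z ^ \<rho>)"
        by (simp add: exp_add[symmetric] algebra_simps)
      finally show "ln_ext (norm (f z)) / ereal (norm z ^ \<rho>) \<le> ereal (p + e)"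
        using z by (subst ln_ext_divide_le_iff) auto
    qed
    then show "(INF R. S R) \<le> ereal p + ereal e"
      by (metis INF_lower2 UNIV_I plus_ereal.simps(1))
  qed
  with tendsto_INF_antimono_at_top[OF \<open>antimono S\<close>] hol show ?thesis
    unfolding E_space_def S_def by blast
qed

lemma E_space_holo: "f \<in> E_space \<rho> p \<Longrightarrow> f holomorphic_on A"
  by (auto simp: E_space_def intro: holomorphic_on_subset)

lemma E_space_add:
  assumes "f \<in> E_space \<rho> p" "g \<in> E_space \<rho> p"
  shows "(\<lambda>z. f z + g z) \<in> E_space \<rho> p"
proof (rule E_spaceI_bound)
  show "(\<lambda>z. f z + g z) holomorphic_on UNIV"
    using assms by (intro holomorphic_intros E_space_holo)
  fix q assume "q > p"
  then obtain C D where "\<And>z. norm (f z) \<le> C * exp (q * norm z ^ \<rho>)"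
     "\<And>z. norm (g z) \<le> D * exp (q * norm z ^ \<rho>)"
    using assms E_spaceD_bound by meson
  then have "norm (f z + g z) \<le> (C + D) * exp (q * norm z ^ \<rho>)" for z
    by (metis add_mono distrib_right norm_triangle_le)
  then show "\<exists>C. \<forall>z. norm (f z + g z) \<le> C * exp (q * norm z ^ \<rho>)" by blast
qed

lemma E_space_cmult:
  assumes "f \<in> E_space \<rho> p"
  shows "(\<lambda>z. c * f z) \<in> E_space \<rho> p"
proof (rule E_spaceI_bound)
  show "(\<lambda>z. c * f z) holomorphic_on UNIV"
    using assms by (intro holomorphic_intros E_space_holo)
  fix q assume "q > p"
  then obtain C where "\<And>z. norm (f z) \<le> C * exp (q * norm z ^ \<rho>)"
    using assms E_spaceD_bound by meson
  then have "norm (c * f z) \<le> (norm c * C) * exp (q * norm z ^ \<rho>)" for z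
    by (simp add: norm_mult mult.assoc mult_left_mono)
  then show "\<exists>C. \<forall>z. norm (c * f z) \<le> C * exp (q * norm z ^ \<rho>)" by blast
qed

lemma E_space_diff:
  assumes "f \<in> E_space \<rho> p" "g \<in> E_space \<rho> p"
  shows "(\<lambda>z. f z - g z) \<in> E_space \<rho> p"
  using E_space_add[OF assms(1) E_space_cmult[OF assms(2), of "-1"]] by simp

lemma E_space_power: "(\<lambda>z. z ^ n) \<in> E_space \<rho> p"
proof (rule E_spaceI_bound)
  show "(\<lambda>z::complex. z ^ n) holomorphic_on UNIV"
    by (intro holomorphic_intros)
  fix q assume q: "q > p"
  \<comment> \<open>\<open>fact n / q ^ n\<close> comes from the \<open>n\<close>-th term of the
    exponential series at \<open>q * norm z ^ \<rho>\<close>, used where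
    \<open>norm z \<ge> 1\<close>; the \<open>1\<close> covers the unit disc.\<close>
  define M where "M = max 1 (fact n / q ^ n)"
  have "norm (z ^ n) \<le> M * exp (q * norm z ^ \<rho>)" for z :: complex
  proof (cases "norm z \<ge> 1")
    case True
    have "(q * norm z ^ \<rho>) ^ n / fact n \<le> exp (q * norm z ^ \<rho>)"
      using p q by (intro power_div_fact_le_exp) auto
    moreover have "(q * norm z) ^ n \<le> (q * norm z ^ \<rho>) ^ n"
      using p q norm_power_rho_ge[OF True order_refl] by (intro power_mono mult_left_mono) auto
    ultimately have "(q * norm z) ^ n / fact n \<le> exp (q * norm z ^ \<rho>)"
      by (smt (verit) divide_right_mono fact_ge_zero)
    then have "norm z ^ n \<le> fact n / q ^ n * exp (q * norm z ^ \<rho>)"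
      using p q by (simp add: power_mult_distrib field_simps)
    also have "\<dots> \<le> M * exp (q * norm z ^ \<rho>)"
      by (intro mult_right_mono) (auto simp: M_def)
    finally show ?thesis by (simp add: norm_power)
  next
    case False
    then have "norm z ^ n \<le> 1" by (simp add: power_le_one)
    moreover have "1 * 1 \<le> M * exp (q * norm z ^ \<rho>)"
      using p q by (intro mult_mono) (auto simp: M_def)
    ultimately show ?thesis by (simp add: norm_power)
  qed
  then show "\<exists>C. \<forall>z::complex. norm (z ^ n) \<le> C * exp (q * norm z ^ \<rho>)" by blast
qed

lemma E_space_poly: "(\<lambda>z. \<Sum>i\<le>n. a i * z ^ i) \<in> E_space \<rho> p"
proof (induction n)
  case 0
  show ?case using E_space_cmult[OF E_space_power[of 0], of "a 0"] by simp
next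
  case (Suc n)
  show ?case
    using E_space_add[OF Suc E_space_cmult[OF E_space_power[of "Suc n"], of "a (Suc n)"]] by simp
qed

section \<open>Norms, balls and neighbourhoods\<close>

lemma E_norm_bdd:
  assumes "f \<in> E_space \<rho> p" "n \<ge> 1"
  shows "bdd_above (range (\<lambda>z. exp (- (p + 1 / real n) * norm z ^ \<rho>) * norm (f z)))"
proof -
  \<comment> \<open>\<open>n \<ge> 1\<close> puts the exponent strictly above \<open>p\<close>,
    where a growth bound is available; \<open>1 / real 0 = 0\<close> would leave it at
    \<open>p\<close>.\<close>
  obtain C where C: "\<And>z. norm (f z) \<le> C * exp ((p + 1 / real n) * norm z ^ \<rho>)"
    using E_spaceD_bound[OF assms(1), of "p + 1 / real n"] assms by auto
  have "exp (- (p + 1 / real n) * norm z ^ \<rho>) * norm (f z) \<le> C" for z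
  proof -
    have "exp (- (p + 1 / real n) * norm z ^ \<rho>) * norm (f z) \<le>
        exp (- (p + 1 / real n) * norm z ^ \<rho>) * (C * exp ((p + 1 / real n) * norm z ^ \<rho>))"
      using C by (intro mult_left_mono) auto
    also have "\<dots> = C * exp (- (p + 1 / real n) * norm z ^ \<rho> + (p + 1 / real n) * norm z ^ \<rho>)"
      by (subst exp_add) simp
    also have "\<dots> = C" by (simp flip: distrib_right)
    finally show ?thesis .
  qed
  then show ?thesis by (intro bdd_aboveI[of _ C]) auto
qed

text \<open>The norm is the best constant in an exponential bound, so the norm inequalities below
  reduce to pointwise estimates.\<close>

lemma E_norm_le_iff:
  assumes "f \<in> E_space \<rho> p" "n \<ge> 1"
  shows "E_norm \<rho> p n f \<le> c \<longleftrightarrow> (\<forall>z. norm (f z) \<le> c * exp ((p + 1 / real n) * norm z ^ \<rho>))"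
proof -
  have "E_norm \<rho> p n f \<le> c \<longleftrightarrow> (\<forall>z. exp (- (p + 1 / real n) * norm z ^ \<rho>) * norm (f z) \<le> c)"
    unfolding E_norm_def using E_norm_bdd[OF assms] by (subst cSUP_le_iff) auto
  also have "\<dots> \<longleftrightarrow> (\<forall>z. norm (f z) \<le> c * exp ((p + 1 / real n) * norm z ^ \<rho>))"
    by (simp add: exp_minus field_simps flip: minus_add_distrib distrib_right)
  finally show ?thesis .
qed

lemma E_norm_bound:
  assumes "f \<in> E_space \<rho> p" "n \<ge> 1"
  shows "norm (f z) \<le> E_norm \<rho> p n f * exp ((p + 1 / real n) * norm z ^ \<rho>)"
  using E_norm_le_iff[OF assms, of "E_norm \<rho> p n f"] by blast

lemma E_norm_nonneg:
  assumes "f \<in> E_space \<rho> p" "n \<ge> 1"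
  shows "E_norm \<rho> p n f \<ge> 0"
proof -
  have "0 \<le> E_norm \<rho> p n f * exp ((p + 1 / real n) * norm (0::complex) ^ \<rho>)"
    using E_norm_bound[OF assms, of 0] by (rule order_trans[OF norm_ge_zero])
  then show ?thesis by (simp add: zero_le_mult_iff)
qed

text \<open>The weights grow with \<open>n\<close>; this directedness lets one ball replace two in
  \<open>openin_E_top_imp_ball\<close>.\<close>

lemma E_norm_mono:
  assumes "f \<in> E_space \<rho> p" "n \<ge> 1" "m \<ge> n"
  shows "E_norm \<rho> p n f \<le> E_norm \<rho> p m f"
proof -
  have "norm (f z) \<le> E_norm \<rho> p m f * exp ((p + 1 / real n) * norm z ^ \<rho>)" for z
  proof -
    have "1 / real m \<le> 1 / real n" using assms by (simp add: frac_le)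
    then have "exp ((p + 1 / real m) * norm z ^ \<rho>) \<le> exp ((p + 1 / real n) * norm z ^ \<rho>)"
      by (simp add: mult_right_mono)
    then have "E_norm \<rho> p m f * exp ((p + 1 / real m) * norm z ^ \<rho>)
        \<le> E_norm \<rho> p m f * exp ((p + 1 / real n) * norm z ^ \<rho>)"
      using E_norm_nonneg[of f m] assms by (intro mult_left_mono) auto
    then show ?thesis using E_norm_bound[of f m z] assms by auto
  qed
  then show ?thesis using assms by (subst E_norm_le_iff) auto
qed

lemma E_norm_add_le:
  assumes "f \<in> E_space \<rho> p" "g \<in> E_space \<rho> p" "n \<ge> 1"
  shows "E_norm \<rho> p n (\<lambda>z. f z + g z) \<le> E_norm \<rho> p n f + E_norm \<rho> p n g"
proof -
  have "norm (f z + g z) \<le> (E_norm \<rho> p n f + E_norm \<rho> p n g) * exp ((p + 1 / real n) * norm z ^ \<rho>)"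
    for z
    using E_norm_bound[OF assms(1,3), of z] E_norm_bound[OF assms(2,3), of z]
    by (metis add_mono distrib_right norm_triangle_le)
  then show ?thesis using assms by (subst E_norm_le_iff) (auto intro: E_space_add)
qed

lemma E_norm_cmult_le:
  assumes "f \<in> E_space \<rho> p" "n \<ge> 1"
  shows "E_norm \<rho> p n (\<lambda>z. c * f z) \<le> norm c * E_norm \<rho> p n f"
proof -
  have "norm (c * f z) \<le> (norm c * E_norm \<rho> p n f) * exp ((p + 1 / real n) * norm z ^ \<rho>)" for z
    using E_norm_bound[OF assms, of z] by (simp add: norm_mult mult.assoc mult_left_mono)
  then show ?thesis using assms by (subst E_norm_le_iff) (auto intro: E_space_cmult)
qed

lemma E_norm_triangle:
  assumes "f \<in> E_space \<rho> p" "g \<in> E_space \<rho> p" "h \<in> E_space \<rho> p" "n \<ge> 1"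
  shows "E_norm \<rho> p n (\<lambda>z. f z - h z) \<le> E_norm \<rho> p n (\<lambda>z. f z - g z) + E_norm \<rho> p n (\<lambda>z. g z - h z)"
  using E_norm_add_le[OF E_space_diff[OF assms(1,2)] E_space_diff[OF assms(2,3)] assms(4)] by simp

lemma E_ball_centre: "f \<in> E_space \<rho> p \<Longrightarrow> \<epsilon> > 0 \<Longrightarrow> f \<in> E_ball \<rho> p n f \<epsilon>"
  by (simp add: E_ball_def E_norm_def)

lemma openin_E_ball:
  "n \<ge> 1 \<Longrightarrow> f \<in> E_space \<rho> p \<Longrightarrow> \<epsilon> > 0 \<Longrightarrow> openin (E_top \<rho> p) (E_ball \<rho> p n f \<epsilon>)"
  unfolding E_top_def by (rule topology_generated_by_Basis) blast

lemma E_ball_mono: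
  assumes "f \<in> E_space \<rho> p" "1 \<le> n" "n \<le> m" "\<epsilon> \<le> \<delta>"
  shows "E_ball \<rho> p m f \<epsilon> \<subseteq> E_ball \<rho> p n f \<delta>"
proof
  fix g assume "g \<in> E_ball \<rho> p m f \<epsilon>"
  then show "g \<in> E_ball \<rho> p n f \<delta>"
    using E_norm_mono[OF E_space_diff[of g f], of n m] assms by (auto simp: E_ball_def)
qed

text \<open>The generating balls are given only as a subbasis, with arbitrary centres. Monotonicity
  of the norms merges two balls about \<open>f\<close> into one, and the triangle inequality
  recentres a generating ball at \<open>f\<close>.\<close>

lemma openin_E_top_imp_ball:
  assumes "openin (E_top \<rho> p) U" "f \<in> U"
  shows "\<exists>n\<ge>1. \<exists>\<epsilon>>0. E_ball \<rho> p n f \<epsilon> \<subseteq> U"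
proof -
  have "U \<subseteq> E_space \<rho> p"
    using openin_subset[OF assms(1)] by (simp add: topspace_E_top)
  have "generate_topology_on {E_ball \<rho> p n f \<epsilon> |n f \<epsilon>. n \<ge> 1 \<and> f \<in> E_space \<rho> p \<and> \<epsilon> > 0} U"
    using assms(1) unfolding E_top_def by (rule openin_topology_generated_by)
  from this assms(2) show ?thesis
  proof (induction rule: generate_topology_on.induct)
    case Empty
    then show ?case by simp
  next
    case (Int a b)
    then obtain n \<epsilon> m \<delta> where *: "n \<ge> 1" "\<epsilon> > 0" "E_ball \<rho> p n f \<epsilon> \<subseteq> a"
        "m \<ge> 1" "\<delta> > 0" "E_ball \<rho> p m f \<delta> \<subseteq> b"
      by blast
    have "f \<in> E_space \<rho> p" using assms \<open>U \<subseteq> _\<close> by blast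
    then have "E_ball \<rho> p (max n m) f (min \<epsilon> \<delta>) \<subseteq> E_ball \<rho> p n f \<epsilon>"
        "E_ball \<rho> p (max n m) f (min \<epsilon> \<delta>) \<subseteq> E_ball \<rho> p m f \<delta>"
      using * by (intro E_ball_mono; simp)+
    with * show ?case
      by (intro exI[of _ "max n m"] conjI exI[of _ "min \<epsilon> \<delta>"]) auto
  next
    case (UN K)
    then show ?case by blast
  next
    case (Basis s)
    then obtain n g \<epsilon> where s: "s = E_ball \<rho> p n g \<epsilon>" "n \<ge> 1" "g \<in> E_space \<rho> p" "\<epsilon> > 0"
      by blast
    define \<delta> where "\<delta> = \<epsilon> - E_norm \<rho> p n (\<lambda>z. f z - g z)"
    have f: "f \<in> E_space \<rho> p" "\<delta> > 0"
      using Basis(2) by (auto simp: s(1) E_ball_def \<delta>_def)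
    have "E_ball \<rho> p n f \<delta> \<subseteq> s"
    proof
      fix h assume "h \<in> E_ball \<rho> p n f \<delta>"
      then show "h \<in> s"
        using E_norm_triangle[of h f g n] s f by (auto simp: E_ball_def \<delta>_def)
    qed
    with f s show ?case by blast
  qed
qed

lemma open_nhd_perturb:
  assumes U: "openin (E_top \<rho> p) U" "f \<in> U" and h: "h \<in> E_space \<rho> p"
  shows "\<exists>r>0. \<forall>c. norm c < r \<longrightarrow> (\<lambda>z. f z + c * h z) \<in> U"
proof -
  obtain n \<epsilon> where n: "n \<ge> 1" "\<epsilon> > 0" "E_ball \<rho> p n f \<epsilon> \<subseteq> U"
    using openin_E_top_imp_ball[OF U] by blast
  have f: "f \<in> E_space \<rho> p"
    using openin_subset[OF U(1)] U(2) by (auto simp: topspace_E_top)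
  define N where "N = E_norm \<rho> p n h"
  have N: "N \<ge> 0" unfolding N_def using h n by (intro E_norm_nonneg)
  \<comment> \<open>\<open>N + 1\<close> instead of \<open>N\<close> avoids a division by zero when
    \<open>h\<close> has norm 0.\<close>
  have "(\<lambda>z. f z + c * h z) \<in> U" if c: "norm c < \<epsilon> / (N + 1)" for c
  proof -
    have "norm c * N \<le> norm c * (N + 1)" by (intro mult_left_mono) auto
    also have "\<dots> < \<epsilon>" using c N by (simp add: pos_less_divide_eq)
    finally have "E_norm \<rho> p n (\<lambda>z. c * h z) < \<epsilon>"
      using E_norm_cmult_le[OF h n(1), of c] by (simp add: N_def)
    then have "(\<lambda>z. f z + c * h z) \<in> E_ball \<rho> p n f \<epsilon>"
      using E_space_add[OF f E_space_cmult[OF h]] by (simp add: E_ball_def)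
    with n show ?thesis by blast
  qed
  moreover have "\<epsilon> / (N + 1) > 0" using n N by simp
  ultimately show ?thesis by blast
qed

subsection \<open>Baire property\<close>

text \<open>If \<open>f\<close> were not interior, each ball of index \<open>Suc j\<close> and
  radius \<open>1 / Suc j\<close> about \<open>f\<close> would contain some \<open>g j\<close>
  outside \<open>T\<close>, and these \<open>g j\<close> converge to \<open>f\<close> locally
  uniformly. Openness can thus be tested by complex analysis, without the norms.\<close>

lemma in_interior_sequentially:
  assumes f: "f \<in> E_space \<rho> p"
    and T: "\<And>g. \<lbrakk>\<And>j::nat. g j \<in> E_space \<rho> p; \<And>R. uniform_limit (cball 0 R) g f sequentially\<rbrakk>
      \<Longrightarrow> \<exists>j. g j \<in> T"
  shows "f \<in> E_top \<rho> p interior_of T"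
proof (rule ccontr)
  assume *: "f \<notin> E_top \<rho> p interior_of T"
  have "\<exists>g. g \<in> E_ball \<rho> p (Suc j) f (1 / Suc j) \<and> g \<notin> T" for j
  proof (rule ccontr)
    assume "\<nexists>g. g \<in> E_ball \<rho> p (Suc j) f (1 / Suc j) \<and> g \<notin> T"
    then have "E_ball \<rho> p (Suc j) f (1 / Suc j) \<subseteq> E_top \<rho> p interior_of T"
      using f by (intro interior_of_maximal openin_E_ball) auto
    with E_ball_centre[OF f, of "1 / Suc j" "Suc j"] * show False by auto
  qed
  then obtain g where g: "\<And>j. g j \<in> E_ball \<rho> p (Suc j) f (1 / Suc j)" "\<And>j. g j \<notin> T"
    by metis
  then have gE: "g j \<in> E_space \<rho> p" for j by (auto simp: E_ball_def)
  have "uniform_limit (cball 0 R) g f sequentially" for R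
  proof (rule uniform_limitI)
    fix e :: real assume e: "e > 0"
    \<comment> \<open>All exponents \<open>p + 1 / Suc j\<close> are at most \<open>p + 1\<close>,
      so one \<open>K\<close> serves every \<open>j\<close>.\<close>
    define K where "K = exp ((p + 1) * \<bar>R\<bar> ^ \<rho>)"
    have "(\<lambda>j. inverse (real (Suc j)) * K) \<longlonglongrightarrow> 0 * K"
      by (intro tendsto_intros LIMSEQ_inverse_real_of_nat)
    then have "\<forall>\<^sub>F j in sequentially. inverse (real (Suc j)) * K < e"
      using order_tendstoD(2)[of _ "0 * K"] e by simp
    then show "\<forall>\<^sub>F j in sequentially. \<forall>z\<in>cball 0 R. dist (g j z) (f z) < e"
    proof eventually_elim
      case (elim j)
      show ?case
      proof
        fix z :: complex assume z: "z \<in> cball 0 R"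
        have d: "(\<lambda>z. g j z - f z) \<in> E_space \<rho> p"
          using E_space_diff[OF gE f] .
        have "norm (g j z - f z)
            \<le> E_norm \<rho> p (Suc j) (\<lambda>z. g j z - f z) * exp ((p + 1 / real (Suc j)) * norm z ^ \<rho>)"
          using E_norm_bound[OF d, of "Suc j" z] by simp
        also have "\<dots> \<le> inverse (real (Suc j)) * K"
        proof (rule mult_mono)
          show "E_norm \<rho> p (Suc j) (\<lambda>z. g j z - f z) \<le> inverse (real (Suc j))"
            using g(1)[of j] by (simp add: E_ball_def divide_inverse)
          show "exp ((p + 1 / real (Suc j)) * norm z ^ \<rho>) \<le> K"
            unfolding K_def exp_le_cancel_iff using p z by (intro mult_mono power_mono) auto
        qed auto
        also have "\<dots> < e" by (rule elim)
        finally show "dist (g j z) (f z) < e" by (simp add: dist_norm)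
      qed
    qed
  qed
  from T[OF gE this] g(2) show False by blast
qed

text \<open>Completeness in the form that nested closed balls supply: centres \<open>s k\<close>,
  norm indices tending to infinity, radii tending to 0.\<close>

lemma E_space_Cauchy_limit:
  assumes s: "\<And>k. s k \<in> E_space \<rho> p"
    and n: "\<And>k. n k \<ge> Suc k" and \<epsilon>: "\<And>k. \<epsilon> k \<le> 1 / Suc k"
    and C: "\<And>k m. k \<le> m \<Longrightarrow> E_norm \<rho> p (n k) (\<lambda>z. s m z - s k z) \<le> \<epsilon> k"
  shows "\<exists>F\<in>E_space \<rho> p. \<forall>k. E_norm \<rho> p (n k) (\<lambda>z. F z - s k z) \<le> \<epsilon> k"
proof -
  have n1: "n k \<ge> 1" for k using n[of k] by simp
  have nk: "1 / real (n k) \<le> 1 / Suc k" for k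
    using n[of k] by (intro divide_left_mono) auto
  have d: "norm (s m z - s k z) \<le> \<epsilon> k * exp ((p + 1 / real (n k)) * norm z ^ \<rho>)" if "k \<le> m" for k m z
    using C[OF that] E_norm_le_iff[OF E_space_diff[OF s s] n1] by blast
  have \<epsilon>0: "\<epsilon> k \<ge> 0" for k
    using C[of k k] E_norm_nonneg[OF E_space_diff[OF s s] n1, of k k k] by linarith
  have small: "\<epsilon> k * exp ((p + 1 / real (n k)) * norm z ^ \<rho>) \<le> inverse (Suc k) * exp ((p + 1) * R ^ \<rho>)"
    if "norm z \<le> R" for k R and z :: complex
  proof (rule mult_mono)
    have "1 / real (n k) \<le> 1" using n1[of k] by simp
    then show "exp ((p + 1 / real (n k)) * norm z ^ \<rho>) \<le> exp ((p + 1) * R ^ \<rho>)"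
      unfolding exp_le_cancel_iff using p that by (intro mult_mono power_mono) auto
  qed (use \<epsilon>[of k] in \<open>auto simp: divide_inverse\<close>)
  have lim0: "(\<lambda>k. inverse (real (Suc k)) * K) \<longlonglongrightarrow> 0" for K
    using tendsto_mult[OF LIMSEQ_inverse_real_of_nat tendsto_const[of K]] by simp
  have "Cauchy (\<lambda>m. s m z)" for z
  proof (rule metric_CauchyI)
    fix e :: real assume "e > 0"
    then have "\<forall>\<^sub>F k in sequentially. inverse (real (Suc k)) * exp ((p + 1) * norm z ^ \<rho>) < e / 2"
      by (intro order_tendstoD(2)[OF lim0]) auto
    then obtain k where k: "inverse (real (Suc k)) * exp ((p + 1) * norm z ^ \<rho>) < e / 2"
      by (auto simp: eventually_sequentially)
    have "dist (s m z) (s k z) < e / 2" if "m \<ge> k" for m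
      unfolding dist_norm
      by (rule le_less_trans[OF d[OF that] le_less_trans[OF small[OF order_refl] k]])
    then have "dist (s m z) (s m' z) < e" if "m \<ge> k" "m' \<ge> k" for m m'
      using that by (metis dist_triangle_half_l)
    then show "\<exists>M. \<forall>m\<ge>M. \<forall>n\<ge>M. dist (s m z) (s n z) < e" by blast
  qed
  define F where "F = (\<lambda>z. lim (\<lambda>m. s m z))"
  have F: "(\<lambda>m. s m z) \<longlonglongrightarrow> F z" for z
    using Cauchy_convergent[OF \<open>Cauchy (\<lambda>m. s m z)\<close>] by (simp add: F_def convergent_LIMSEQ_iff)
  have dF: "norm (F z - s k z) \<le> \<epsilon> k * exp ((p + 1 / real (n k)) * norm z ^ \<rho>)" for k z
    by (rule LIMSEQ_le_const2[OF tendsto_norm[OF tendsto_diff[OF F tendsto_const]]])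
      (use d in blast)
  have "F holomorphic_on UNIV"
  proof (rule holomorphic_uniform_sequence)
    fix z :: complex
    have "uniform_limit (cball z 1) s F sequentially"
    proof (rule uniform_limitI)
      fix e :: real assume "e > 0"
      then have "\<forall>\<^sub>F k in sequentially. inverse (real (Suc k)) * exp ((p + 1) * (norm z + 1) ^ \<rho>) < e"
        by (intro order_tendstoD(2)[OF lim0])
      then show "\<forall>\<^sub>F k in sequentially. \<forall>x\<in>cball z 1. dist (s k x) (F x) < e"
      proof eventually_elim
        case (elim k)
        show ?case
        proof
          fix x assume "x \<in> cball z 1"
          then have "norm x \<le> norm z + 1"
            using norm_triangle_ineq2[of x z] by (auto simp: dist_norm norm_minus_commute)
          have "norm (F x - s k x) < e"
            by (rule le_less_trans[OF dF le_less_trans[OF small[OF \<open>norm x \<le> _\<close>] elim]])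
          then show "dist (s k x) (F x) < e"
            by (simp add: dist_norm norm_minus_commute)
        qed
      qed
    qed
    then show "\<exists>d>0. cball z d \<subseteq> UNIV \<and> uniform_limit (cball z d) s F sequentially"
      by (intro exI[of _ 1]) auto
  qed (use s in \<open>auto intro: E_space_holo\<close>)
  then have FE: "F \<in> E_space \<rho> p"
  proof (rule E_spaceI_bound)
    fix q assume q: "q > p"
    \<comment> \<open>As the norm indices grow, some error \<open>F - s k\<close> is bounded with
      exponent at most \<open>q\<close>; the growth of \<open>F\<close> is then inherited from this
      single \<open>s k\<close>.\<close>
    obtain k where "inverse (real (Suc k)) < q - p"
      using q reals_Archimedean[of "q - p"] by auto
    then have "p + 1 / real (n k) \<le> q"
      using nk[of k] by (simp add: divide_inverse)
    then have le: "exp ((p + 1 / real (n k)) * norm z ^ \<rho>) \<le> exp (q * norm z ^ \<rho>)" for z :: complex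
      by (simp add: mult_right_mono)
    obtain C where C: "\<And>z. norm (s k z) \<le> C * exp (q * norm z ^ \<rho>)"
      using E_spaceD_bound[OF s q] by blast
    have "norm (F z) \<le> (\<epsilon> k + C) * exp (q * norm z ^ \<rho>)" for z
    proof -
      have "norm (F z) \<le> norm (F z - s k z) + norm (s k z)"
        by (metis add.commute norm_triangle_sub)
      also have "\<dots> \<le> \<epsilon> k * exp (q * norm z ^ \<rho>) + C * exp (q * norm z ^ \<rho>)"
        by (intro add_mono C order_trans[OF dF mult_left_mono[OF le \<epsilon>0]])
      finally show ?thesis by (simp add: distrib_right)
    qed
    then show "\<exists>C. \<forall>z. norm (F z) \<le> C * exp (q * norm z ^ \<rho>)" by blast
  qed
  moreover have "E_norm \<rho> p (n k) (\<lambda>z. F z - s k z) \<le> \<epsilon> k" for k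
    using dF E_norm_le_iff[OF E_space_diff[OF FE s] n1] by blast
  ultimately show ?thesis by blast
qed

text \<open>Centre, norm index and radius form one triple, so that a nested sequence of balls comes
  from a single dependent choice.\<close>

definition E_cball :: "(complex \<Rightarrow> complex) \<times> nat \<times> real \<Rightarrow> (complex \<Rightarrow> complex) set" where
  "E_cball = (\<lambda>(f, n, \<epsilon>). {g \<in> E_space \<rho> p. E_norm \<rho> p n (\<lambda>z. g z - f z) \<le> \<epsilon>})"

lemma ex_E_cball_subset:
  assumes U: "openin (E_top \<rho> p) U" "f \<in> U"
  shows "\<exists>n \<epsilon>. n \<ge> Suc k \<and> 0 < \<epsilon> \<and> \<epsilon> \<le> 1 / Suc k \<and> E_cball (f, n, \<epsilon>) \<subseteq> U"
proof -
  obtain m \<delta> where m: "m \<ge> 1" "\<delta> > 0" "E_ball \<rho> p m f \<delta> \<subseteq> U"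
    using openin_E_top_imp_ball[OF U] by blast
  have f: "f \<in> E_space \<rho> p"
    using openin_subset[OF U(1)] U(2) by (auto simp: topspace_E_top)
  \<comment> \<open>Half the radius places the closed ball inside the open one; the cap
    \<open>1 / Suc k\<close> makes the radii tend to 0.\<close>
  define \<epsilon> where "\<epsilon> = min (\<delta> / 2) (1 / Suc k)"
  have "E_cball (f, max m (Suc k), \<epsilon>) \<subseteq> E_ball \<rho> p (max m (Suc k)) f \<delta>"
    using m by (auto simp: E_cball_def E_ball_def \<epsilon>_def)
  also have "\<dots> \<subseteq> E_ball \<rho> p m f \<delta>"
    using m f by (intro E_ball_mono) auto
  finally show ?thesis
    using m by (intro exI[of _ "max m (Suc k)"] exI[of _ \<epsilon>]) (auto simp: \<epsilon>_def)
qed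

text \<open>Nested closed balls are chosen inside \<open>W k \<inter> T\<close>; the limit of their
  centres satisfies all the nonstrict ball inequalities, hence lies in every one of them.\<close>

lemma Baire_E_top:
  fixes W :: "nat \<Rightarrow> (complex \<Rightarrow> complex) set"
  assumes op: "\<And>k. openin (E_top \<rho> p) (W k)"
    and dense: "\<And>k. E_top \<rho> p closure_of W k = E_space \<rho> p"
  shows "E_top \<rho> p closure_of (\<Inter>k. W k) = E_space \<rho> p"
proof -
  have meets: "W k \<inter> U \<noteq> {}" if "openin (E_top \<rho> p) U" "U \<noteq> {}" for k U
    using dense[of k] dense_intersects_open[of "E_top \<rho> p" "W k"] that
    by (auto simp: topspace_E_top)
  have "(\<Inter>k. W k) \<inter> T \<noteq> {}" if T: "openin (E_top \<rho> p) T" "T \<noteq> {}" for T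
  proof -
    define P where "P = (\<lambda>k (s::(complex \<Rightarrow> complex) \<times> nat \<times> real).
      fst s \<in> E_space \<rho> p \<and> fst (snd s) \<ge> Suc k \<and> 0 < snd (snd s) \<and> snd (snd s) \<le> 1 / Suc k
        \<and> E_cball s \<subseteq> W k \<inter> T)"
    have step: "\<exists>s. P k s \<and> E_cball s \<subseteq> U"
      if U: "openin (E_top \<rho> p) U" "U \<noteq> {}" "U \<subseteq> T" for U k
    proof -
      obtain f where f: "f \<in> W k \<inter> U" using meets[OF U(1,2)] by blast
      then obtain n \<epsilon> where "n \<ge> Suc k" "0 < \<epsilon>" "\<epsilon> \<le> 1 / Suc k" "E_cball (f, n, \<epsilon>) \<subseteq> W k \<inter> U"
        using ex_E_cball_subset[OF openin_Int[OF op U(1)] f] by blast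
      moreover have "f \<in> E_space \<rho> p"
        using f openin_subset[OF U(1)] by (auto simp: topspace_E_top)
      ultimately show ?thesis using U
        by (intro exI[of _ "(f, n, \<epsilon>)"]) (auto simp: P_def)
    qed
    have "\<exists>s. \<forall>k. P k (s k) \<and> E_cball (s (Suc k)) \<subseteq> E_cball (s k)"
    proof (rule dependent_nat_choice)
      show "\<exists>s. P 0 s" using step[OF T order_refl] by blast
    next
      fix s k assume s: "P k s"
      obtain f n \<epsilon> where [simp]: "s = (f, n, \<epsilon>)" by (cases s)
      \<comment> \<open>The open ball with the same data is a nonempty open set in which the next
        closed ball can be sought.\<close>
      have "E_ball \<rho> p n f \<epsilon> \<subseteq> E_cball s" by (auto simp: E_cball_def E_ball_def)
      moreover have "openin (E_top \<rho> p) (E_ball \<rho> p n f \<epsilon>)" "E_ball \<rho> p n f \<epsilon> \<noteq> {}"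
        using s openin_E_ball[of n f \<epsilon>] E_ball_centre[of f \<epsilon> n] by (auto simp: P_def)
      moreover have "E_cball s \<subseteq> T" using s by (auto simp: P_def)
      ultimately show "\<exists>y. P (Suc k) y \<and> E_cball y \<subseteq> E_cball s"
        using step[of "E_ball \<rho> p n f \<epsilon>" "Suc k"] by (meson subset_trans)
    qed
    then obtain s where s: "\<And>k. P k (s k)" "\<And>k. E_cball (s (Suc k)) \<subseteq> E_cball (s k)"
      by blast
    define f where "f = (\<lambda>k. fst (s k))"
    define n where "n = (\<lambda>k. fst (snd (s k)))"
    define \<epsilon> where "\<epsilon> = (\<lambda>k. snd (snd (s k)))"
    have eq: "s k = (f k, n k, \<epsilon> k)" for k by (simp add: f_def n_def \<epsilon>_def)
    have fm: "f m \<in> E_cball (s k)" if "k \<le> m" for k m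
    proof -
      have "f m \<in> E_cball (s m)"
        using s(1)[of m] by (auto simp: P_def E_cball_def eq E_norm_def)
      also have "E_cball (s m) \<subseteq> E_cball (s k)"
        using lift_Suc_antimono_le[of "\<lambda>k. E_cball (s k)"] s(2) that by blast
      finally show ?thesis .
    qed
    have "\<exists>F\<in>E_space \<rho> p. \<forall>k. E_norm \<rho> p (n k) (\<lambda>z. F z - f k z) \<le> \<epsilon> k"
      using s(1) fm by (intro E_space_Cauchy_limit) (auto simp: P_def E_cball_def eq)
    then obtain F where "\<And>k. F \<in> E_cball (s k)" by (auto simp: E_cball_def eq)
    then have "F \<in> W k \<inter> T" for k using s(1)[of k] by (auto simp: P_def)
    then show ?thesis by blast
  qed
  then show ?thesis
    using dense_intersects_open[of "E_top \<rho> p" "\<Inter>k. W k"] by (simp add: topspace_E_top)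
qed

subsection \<open>Density of polynomials\<close>

lemma poly_in_E_space: "poly P \<in> E_space \<rho> p"
proof -
  have "poly P = (\<lambda>z. \<Sum>i\<le>degree P. coeff P i * z ^ i)"
    by (simp add: fun_eq_iff poly_altdef)
  then show ?thesis using E_space_poly by simp
qed

text \<open>The Cauchy estimate on the circle of radius \<open>norm z / t\<close>: the quotient of the two radii
  produces the geometric factor \<open>t ^ k\<close>, while the exponent \<open>q * t ^ \<rho>\<close> is enlarged to \<open>q\<close>.\<close>

lemma taylor_term_bound:
  assumes f: "f holomorphic_on UNIV" and C: "\<And>z. norm (f z) \<le> C * exp (q * t ^ \<rho> * norm z ^ \<rho>)"
    and t: "t > 0"
  shows "norm ((deriv ^^ k) f 0 / fact k * z ^ k) \<le> C * t ^ k * exp (q * norm z ^ \<rho>)"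
proof (cases "z = 0")
  case True
  have "norm (f 0) \<le> C" using C[of 0] rho by (simp add: power_0_left)
  moreover from this have "C \<ge> 0" by (rule order_trans[OF norm_ge_zero])
  ultimately show ?thesis using True rho t by (cases "k = 0") (auto simp: power_0_left)
next
  case False
  define s where "s = norm z / t"
  have s: "s > 0" "norm z = s * t" using False t by (auto simp: s_def)
  have "norm ((deriv ^^ k) f 0) \<le> fact k * (C * exp (q * norm z ^ \<rho>)) / s ^ k"
  proof (rule Cauchy_inequality)
    fix x :: complex assume "norm (0 - x) = s"
    then show "norm (f x) \<le> C * exp (q * norm z ^ \<rho>)"
      using C[of x] by (simp add: s(2) power_mult_distrib mult_ac)
  qed (use s f in \<open>auto intro: holomorphic_on_subset holomorphic_on_imp_continuous_on\<close>)
  then have "norm ((deriv ^^ k) f 0) * s ^ k \<le> fact k * (C * exp (q * norm z ^ \<rho>))"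
    using s(1) by (simp add: pos_le_divide_eq)
  then have "norm ((deriv ^^ k) f 0) * s ^ k / fact k \<le> C * exp (q * norm z ^ \<rho>)"
    by (simp add: pos_divide_le_eq mult.commute)
  then have "norm ((deriv ^^ k) f 0) * s ^ k / fact k * t ^ k \<le> C * exp (q * norm z ^ \<rho>) * t ^ k"
    using t by (intro mult_right_mono) auto
  then show ?thesis
    by (simp add: norm_mult norm_divide norm_power s(2) power_mult_distrib mult_ac)
qed

lemma ex_poly_in_E_ball:
  assumes f: "f \<in> E_space \<rho> p" and n: "n \<ge> 1" and \<epsilon>: "\<epsilon> > 0"
  shows "\<exists>P. poly P \<in> E_ball \<rho> p n f \<epsilon>"
proof -
  define q where "q = p + 1 / real n"
  \<comment> \<open>\<open>q0\<close> lies midway between \<open>p\<close> and \<open>q\<close>, and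
    \<open>t\<close> solves \<open>q * t ^ \<rho> = q0\<close>: growth of \<open>f\<close> with
    exponent \<open>q0\<close> bounds its Taylor terms by a multiple of
    \<open>t ^ k * exp (q * norm z ^ \<rho>)\<close>, summable in \<open>k\<close> since
    \<open>t < 1\<close>.\<close>
  define q0 where "q0 = p + 1 / (2 * real n)"
  define t where "t = root \<rho> (q0 / q)"
  have q: "0 < q0" "p < q0" "q0 < q"
    using p n by (auto simp: q_def q0_def field_simps add_pos_pos)
  have t: "0 < t" "t < 1" "t ^ \<rho> = q0 / q"
    using q rho by (auto simp: t_def)
  obtain C where C0: "C \<ge> 0" and "\<And>z. norm (f z) \<le> C * exp (q0 * norm z ^ \<rho>)"
    using E_spaceD_bound[OF f q(2)] by blast
  then have C: "norm (f z) \<le> C * exp (q * t ^ \<rho> * norm z ^ \<rho>)" for z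
    using q by (simp add: t(3))
  have hol: "f holomorphic_on A" for A using f by (rule E_space_holo)
  define a where "a = (\<lambda>k. (deriv ^^ k) f 0 / fact k)"
  define T where "T = (\<lambda>N. \<Sum>i<N. monom (a i) i)"
  have T: "poly (T N) z = (\<Sum>i<N. a i * z ^ i)" for N z
    by (simp add: T_def poly_sum poly_monom)
  have tail: "norm (poly (T N) z - f z) \<le> C * t ^ N / (1 - t) * exp (q * norm z ^ \<rho>)" for N z
  proof -
    have "(\<lambda>i. a i * z ^ i) sums f z"
      using holomorphic_power_series[OF hol, of z 0 "norm z + 1"] by (simp add: a_def)
    then have tl: "(\<lambda>i. a (i + N) * z ^ (i + N)) sums (f z - poly (T N) z)"
      unfolding T by (rule sums_split_initial_segment)
    have "(\<lambda>i. (C * t ^ N * exp (q * norm z ^ \<rho>)) * t ^ i) sums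
        ((C * t ^ N * exp (q * norm z ^ \<rho>)) * (1 / (1 - t)))"
      using t by (intro sums_mult geometric_sums) auto
    then have g: "(\<lambda>i. C * t ^ (i + N) * exp (q * norm z ^ \<rho>)) sums
        (C * t ^ N / (1 - t) * exp (q * norm z ^ \<rho>))"
      by (simp add: power_add mult_ac)
    have bd: "norm (a i * z ^ i) \<le> C * t ^ i * exp (q * norm z ^ \<rho>)" for i
      using taylor_term_bound[OF hol C t(1)] by (simp add: a_def)
    have "norm (\<Sum>i. a (i + N) * z ^ (i + N)) \<le> (\<Sum>i. C * t ^ (i + N) * exp (q * norm z ^ \<rho>))"
      by (intro norm_suminf_le bd sums_summable[OF g])
    then show ?thesis
      by (simp only: sums_unique[OF tl, symmetric] sums_unique[OF g, symmetric] norm_minus_commute)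
  qed
  have "(\<lambda>N. C * t ^ N / (1 - t)) \<longlonglongrightarrow> C * 0 / (1 - t)"
    using t by (intro tendsto_intros LIMSEQ_power_zero) auto
  then have "\<forall>\<^sub>F N in sequentially. C * t ^ N / (1 - t) < \<epsilon>"
    using \<epsilon> by (intro order_tendstoD(2)) auto
  then obtain N where N: "C * t ^ N / (1 - t) < \<epsilon>"
    by (auto simp: eventually_sequentially)
  have "E_norm \<rho> p n (\<lambda>z. poly (T N) z - f z) \<le> C * t ^ N / (1 - t)"
    using tail n by (subst E_norm_le_iff) (auto intro: E_space_diff poly_in_E_space f simp: q_def)
  with N have "poly (T N) \<in> E_ball \<rho> p n f \<epsilon>"
    by (simp add: E_ball_def poly_in_E_space)
  then show ?thesis ..
qed

lemma ex_nonconstant_poly_in_open: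
  assumes "openin (E_top \<rho> p) U" "U \<noteq> {}"
  shows "\<exists>P. degree P > 0 \<and> poly P \<in> U"
proof -
  obtain f where "f \<in> U" using assms by blast
  then obtain n \<epsilon> where n: "n \<ge> 1" "\<epsilon> > 0" "E_ball \<rho> p n f \<epsilon> \<subseteq> U"
    using openin_E_top_imp_ball[OF assms(1)] by blast
  have "f \<in> E_space \<rho> p"
    using openin_subset[OF assms(1)] \<open>f \<in> U\<close> by (auto simp: topspace_E_top)
  then obtain P where "poly P \<in> E_ball \<rho> p n f \<epsilon>" using ex_poly_in_E_ball n by blast
  then have "poly P \<in> U" using n(3) by blast
  \<comment> \<open>A degree above that of \<open>P\<close> rules out cancellation of the leading
    term, also when \<open>P\<close> is constant.\<close>
  define h :: "complex poly" where "h = monom 1 (Suc (degree P))"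
  obtain r where r: "r > 0" "\<And>c. norm c < r \<Longrightarrow> (\<lambda>z. poly P z + c * poly h z) \<in> U"
    using open_nhd_perturb[OF assms(1) \<open>poly P \<in> U\<close> poly_in_E_space] by blast
  define c where "c = complex_of_real (r / 2)"
  have c: "c \<noteq> 0" "norm c < r" using r(1) by (auto simp: c_def)
  have "degree (P + smult c h) = degree (smult c h)"
    using c(1) by (intro degree_add_eq_right) (simp add: h_def degree_monom_eq)
  then have "degree (P + smult c h) > 0" using c(1) by (simp add: h_def degree_monom_eq)
  moreover have "poly (P + smult c h) = (\<lambda>z. poly P z + c * poly h z)" by (simp add: fun_eq_iff)
  ultimately show ?thesis using r(2)[OF c(2)] by metis
qed

subsection \<open>Density of typical behaviour on discs\<close>

text \<open>Positive degree of the derivative is recorded because Hurwitz's theorem will be applied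
  to the derivative, which must be nonconstant.\<close>

lemma ex_far_critical_poly_in_open:
  assumes U: "openin (E_top \<rho> p) U" "U \<noteq> {}"
  shows "\<exists>P w. poly P \<in> U \<and> degree (pderiv P) > 0 \<and> poly (pderiv P) w = 0 \<and> norm w > k"
proof -
  obtain P where P: "degree P > 0" "poly P \<in> U" using ex_nonconstant_poly_in_open[OF U] by blast
  define d where "d = degree P"
  \<comment> \<open>Normalised so that the derivative is exactly \<open>monom 1 d\<close>; the
    equation for \<open>w\<close> to be critical then gives \<open>c\<close> as the quotient of
    \<open>- poly (pderiv P) w\<close> by \<open>w ^ d\<close>, small for distant \<open>w\<close>
    by comparison of degrees.\<close>
  define h :: "complex poly" where "h = smult (1 / of_nat (Suc d)) (monom 1 (Suc d))"
  have degh: "degree h = Suc d"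
    unfolding h_def by (simp add: degree_monom_eq del: of_nat_Suc)
  have h': "pderiv h = monom 1 d"
    by (simp add: h_def pderiv_smult pderiv_monom smult_monom del: of_nat_Suc)
  obtain r where r: "r > 0" "\<And>c. norm c < r \<Longrightarrow> (\<lambda>z. poly P z + c * poly h z) \<in> U"
    using open_nhd_perturb[OF U(1) P(2) poly_in_E_space] by blast
  have "degree (pderiv P) < d"
    using P(1) by (simp add: degree_pderiv d_def)
  from tendstoD[OF poly_over_power_tendsto_0[OF this] r(1)]
  have "\<forall>\<^sub>F w in at_infinity. norm (poly (pderiv P) w / w ^ d) < r" by simp
  \<comment> \<open>\<open>\<bar>k\<bar> + 1\<close> yields both \<open>norm w > k\<close> and
    \<open>w \<noteq> 0\<close>, whatever the sign of \<open>k\<close>.\<close>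
  moreover have "\<forall>\<^sub>F w::complex in at_infinity. norm w \<ge> \<bar>k\<bar> + 1"
    by (auto simp: eventually_at_infinity)
  ultimately have "\<forall>\<^sub>F w in at_infinity. norm (poly (pderiv P) w / w ^ d) < r \<and> norm w \<ge> \<bar>k\<bar> + 1"
    by (rule eventually_conj)
  then obtain w where w: "norm (poly (pderiv P) w / w ^ d) < r" "norm w \<ge> \<bar>k\<bar> + 1"
    using eventually_happens' trivial_limit_at_infinity by blast
  have "w \<noteq> 0" using w(2) by auto
  define c where "c = - poly (pderiv P) w / w ^ d"
  define Q where "Q = P + smult c h"
  have "poly Q = (\<lambda>z. poly P z + c * poly h z)" by (simp add: Q_def fun_eq_iff)
  then have "poly Q \<in> U" using r(2)[of c] w(1) by (simp add: c_def norm_divide)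
  moreover have "poly (pderiv Q) w = poly (pderiv P) w + c * w ^ d"
    by (simp add: Q_def pderiv_add pderiv_smult h' poly_monom)
  then have root: "poly (pderiv Q) w = 0" using \<open>w \<noteq> 0\<close> by (simp add: c_def)
  moreover have "degree Q > 0"
  proof (cases "c = 0")
    case False
    then have "degree Q = degree (smult c h)"
      unfolding Q_def by (intro degree_add_eq_right) (simp add: degh d_def)
    with False show ?thesis by (simp add: degh)
  qed (simp add: Q_def P)
  then have "pderiv Q \<noteq> 0" by (simp add: pderiv_eq_0_iff)
  with root have "degree (pderiv Q) > 0"
    by (metis degree_eq_zeroE gr0I mult_zero_right pCons_0_0 poly_0 poly_pCons add_0_right)
  ultimately show ?thesis using w(2) by (intro exI[of _ Q] exI[of _ w]) auto
qed

text \<open>Needed both for the final disc condition and to keep functions nondegenerate while their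
  critical values are being separated.\<close>

lemma nondegenerate_interior:
  assumes f: "f \<in> E_space \<rho> p" and nd: "\<forall>z\<in>cball 0 k. deriv f z = 0 \<longrightarrow> deriv (deriv f) z \<noteq> 0"
  shows "f \<in> E_top \<rho> p interior_of {f. \<forall>z\<in>cball 0 k. deriv f z = 0 \<longrightarrow> deriv (deriv f) z \<noteq> 0}"
proof (rule in_interior_sequentially[OF f])
  fix g :: "nat \<Rightarrow> complex \<Rightarrow> complex"
  assume "\<And>j. g j \<in> E_space \<rho> p" and lim: "\<And>R. uniform_limit (cball 0 R) g f sequentially"
  then show "\<exists>j. g j \<in> {f. \<forall>z\<in>cball 0 k. deriv f z = 0 \<longrightarrow> deriv (deriv f) z \<noteq> 0}"
    using nondegenerate_stable[OF _ E_space_holo[OF f] lim nd] by (simp add: E_space_holo)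
qed

lemma ex_morse_in_open:
  assumes U: "openin (E_top \<rho> p) U" "U \<noteq> {}"
  shows "\<exists>f\<in>U. (\<forall>z\<in>cball 0 k. deriv f z = 0 \<longrightarrow> deriv (deriv f) z \<noteq> 0)
    \<and> inj_on f {z\<in>cball 0 k. deriv f z = 0}"
proof -
  obtain f0 where f0: "f0 \<in> U" using U by blast
  have UE: "f \<in> E_space \<rho> p" if "f \<in> U" for f
    using openin_subset[OF U(1)] that by (auto simp: topspace_E_top)
  have hol0: "f0 holomorphic_on UNIV" using UE[OF f0] by (rule E_space_holo)
  obtain r where r: "r > 0" "\<And>c. norm c < r \<Longrightarrow> (\<lambda>z. f0 z + c * poly [:0, 1:] z) \<in> U"
    using open_nhd_perturb[OF U(1) f0 poly_in_E_space] by blast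
  \<comment> \<open>A ball of parameters is uncountable; the minus sign appears because
    \<open>deriv f0 z + c = 0\<close> means \<open>c = - deriv f0 z\<close>.\<close>
  have "\<not> ball 0 r \<subseteq> uminus ` (deriv f0 ` {z. deriv (deriv f0) z = 0})"
    using countable_degenerate_slopes[OF hol0] uncountable_ball[OF r(1), of "0::complex"]
    by (metis countable_image countable_subset)
  then obtain c where c: "norm c < r" "c \<notin> uminus ` (deriv f0 ` {z. deriv (deriv f0) z = 0})"
    by (auto simp: subset_iff)
  define f where "f = (\<lambda>z. f0 z + c * z)"
  have fU: "f \<in> U" using r(2)[OF c(1)] by (simp add: f_def mult.commute)
  have f: "f \<in> E_space \<rho> p" "f holomorphic_on UNIV" using UE[OF fU] E_space_holo by auto
  have df: "deriv f = (\<lambda>z. deriv f0 z + c)"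
    unfolding f_def
    by (rule ext, rule DERIV_imp_deriv)
      (use hol0 in \<open>auto intro!: derivative_eq_intros holomorphic_derivI\<close>)
  have ddf: "deriv (deriv f) z = deriv (deriv f0) z" for z
    unfolding df by (rule DERIV_imp_deriv)
      (use deriv_entire[OF hol0] in \<open>auto intro!: derivative_eq_intros holomorphic_derivI\<close>)
  have nd: "deriv (deriv f) z \<noteq> 0" if "deriv f z = 0" for z
  proof
    assume "deriv (deriv f) z = 0"
    moreover have "c = - deriv f0 z" using that by (simp add: df eq_neg_iff_add_eq_0 add.commute)
    ultimately show False using c(2) by (simp add: ddf)
  qed
  define N where "N = {f. \<forall>z\<in>cball 0 k. deriv f z = 0 \<longrightarrow> deriv (deriv f) z \<noteq> (0::complex)}"
  define Z where "Z = {z\<in>cball 0 k. deriv f z = 0}"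
  have "finite Z" unfolding Z_def by (rule finite_critical_points_cball[OF f(2) nd])
  \<comment> \<open>On \<open>Z\<close> the perturbed values are \<open>f z + e * z\<close>; the
    coefficients of \<open>e\<close> differ at distinct points, so each pair collides for just one
    \<open>e\<close>.\<close>
  obtain P where P: "\<And>z. z \<in> Z \<Longrightarrow> poly P z = z" "\<And>z. z \<in> Z \<Longrightarrow> poly (pderiv P) z = 0"
    using hermite_interpolation[OF \<open>finite Z\<close>, of "\<lambda>z. z" "\<lambda>z. 0"] by blast
  have "f \<in> U \<inter> E_top \<rho> p interior_of N"
    using fU nondegenerate_interior[OF f(1), of k] nd by (simp add: N_def)
  then obtain s where s: "s > 0" "\<And>c. norm c < s \<Longrightarrow> (\<lambda>z. f z + c * poly P z) \<in> U \<inter> E_top \<rho> p interior_of N"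
    using open_nhd_perturb[OF openin_Int[OF U(1) openin_interior_of] _ poly_in_E_space] by blast
  \<comment> \<open>The collision parameters, obtained by solving
    \<open>f a + e * a = f b + e * b\<close> for \<open>e\<close>. Diagonal pairs contribute
    \<open>0 / 0 = 0\<close>, and \<open>t\<close> bounds only the nonzero elements.\<close>
  define B where "B = (\<lambda>(a, b). (f a - f b) / (b - a)) ` (Z \<times> Z)"
  have "finite B" using \<open>finite Z\<close> by (simp add: B_def)
  then obtain t where t: "t > 0" "\<And>x. x \<in> B \<Longrightarrow> x \<noteq> 0 \<Longrightarrow> t \<le> norm x"
    using finite_set_avoid[of B 0] by auto
  \<comment> \<open>\<open>Suc (Suc j)\<close> makes the factor at most 1/2, so
    \<open>norm (e j)\<close> is strictly below \<open>s\<close> and \<open>t\<close> already for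
    \<open>j = 0\<close>; a whole null sequence is needed for
    \<open>no_new_critical_points\<close>.\<close>
  define e where "e = (\<lambda>j. complex_of_real (min s t * inverse (real (Suc (Suc j)))))"
  have e: "e j \<noteq> 0" "norm (e j) < s" "norm (e j) < t" for j
  proof -
    have "min s t * inverse (real (Suc (Suc j))) < min s t * 1"
      using s(1) t(1) by (intro mult_strict_left_mono) (auto simp: field_simps)
    moreover have "0 < min s t * inverse (real (Suc (Suc j)))"
      using s(1) t(1) by (intro mult_pos_pos) auto
    ultimately show "e j \<noteq> 0" "norm (e j) < s" "norm (e j) < t"
      unfolding e_def norm_of_real by (auto simp del: of_nat_Suc)
  qed
  have "(\<lambda>j. min s t * inverse (real (Suc (Suc j)))) \<longlonglongrightarrow> min s t * 0"
    by (intro tendsto_intros LIMSEQ_Suc[OF LIMSEQ_inverse_real_of_nat])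
  then have "e \<longlonglongrightarrow> 0" unfolding e_def using tendsto_of_real[where 'a=complex] by fastforce
  define g where "g = (\<lambda>j z. f z + e j * poly P z)"
  have g: "g j \<in> U" "g j \<in> N" for j
    using s(2)[OF e(2)[of j]] interior_of_subset[of "E_top \<rho> p" N] by (auto simp: g_def)
  have dg: "deriv (g j) z = deriv f z + e j * poly (pderiv P) z" for j z
    unfolding g_def by (rule DERIV_imp_deriv)
      (use f(2) in \<open>auto intro!: derivative_eq_intros holomorphic_derivI\<close>)
  have "\<exists>j. \<forall>z\<in>cball 0 k. deriv (g j) z = 0 \<longrightarrow> deriv f z = 0"
  proof (rule no_new_critical_points)
    show "g j holomorphic_on UNIV" for j using UE[OF g(1)] by (rule E_space_holo)
    show "deriv (g j) z = 0" if "z \<in> cball 0 k" "deriv f z = 0" for j z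
      using that P(2)[of z] by (simp add: dg Z_def)
    show "uniform_limit (cball 0 R) g f sequentially" for R
    proof (rule uniform_limitI)
      fix \<epsilon> :: real assume \<epsilon>: "\<epsilon> > 0"
      have "compact (poly P ` cball 0 R)" by (intro compact_continuous_image continuous_intros) auto
      then obtain M where M: "M > 0" "\<And>z. z \<in> cball 0 R \<Longrightarrow> norm (poly P z) \<le> M"
        by (metis compact_imp_bounded bounded_pos imageI)
      have "\<forall>\<^sub>F j in sequentially. dist (e j) 0 < \<epsilon> / M"
        using \<open>e \<longlonglongrightarrow> 0\<close> \<epsilon> M(1) by (intro tendstoD) auto
      then show "\<forall>\<^sub>F j in sequentially. \<forall>z\<in>cball 0 R. dist (g j z) (f z) < \<epsilon>"
      proof eventually_elim
        case (elim j)
        show ?case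
        proof
          fix z :: complex assume "z \<in> cball 0 R"
          then have "norm (e j) * norm (poly P z) \<le> norm (e j) * M"
            by (intro mult_left_mono M) auto
          also have "\<dots> < \<epsilon>" using elim M(1) by (simp add: pos_less_divide_eq)
          finally show "dist (g j z) (f z) < \<epsilon>" by (simp add: g_def dist_norm norm_mult)
        qed
      qed
    qed
  qed (use f nd in auto)
  then obtain j where j: "\<And>z. z \<in> cball 0 k \<Longrightarrow> deriv (g j) z = 0 \<Longrightarrow> z \<in> Z"
    unfolding Z_def by blast
  have "inj_on (g j) {z\<in>cball 0 k. deriv (g j) z = 0}"
  proof (rule inj_onI, rule ccontr)
    fix a b assume "a \<in> {z\<in>cball 0 k. deriv (g j) z = 0}" "b \<in> {z\<in>cball 0 k. deriv (g j) z = 0}"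
      and eq: "g j a = g j b" and "a \<noteq> b"
    then have ab: "a \<in> Z" "b \<in> Z" using j by auto
    then have "e j * (b - a) = f a - f b" using eq P(1) by (simp add: g_def algebra_simps)
    then have "e j = (f a - f b) / (b - a)" using \<open>a \<noteq> b\<close> by (simp add: field_simps)
    then have "e j \<in> B" using ab by (auto simp: B_def)
    from t(2)[OF this e(1)] e(3)[of j] show False by simp
  qed
  with g show ?thesis by (intro bexI[of _ "g j"]) (auto simp: N_def)
qed

text \<open>Interiors are essential: for \<open>k > 0\<close>, \<open>z ^ 4\<close> has one critical
  point in the disc, but nearby \<open>(z ^ 2 - a ^ 2) ^ 2\<close> takes the same value at its
  critical points \<open>a\<close> and \<open>- a\<close>; a constant has far critical points, which
  a small multiple of \<open>z\<close> destroys.\<close>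

definition typical_on_disc :: "real \<Rightarrow> (complex \<Rightarrow> complex) set" where
  "typical_on_disc k =
     E_top \<rho> p interior_of {f. \<forall>z\<in>cball 0 k. deriv f z = 0 \<longrightarrow> deriv (deriv f) z \<noteq> 0} \<inter>
     E_top \<rho> p interior_of {f. inj_on f {z\<in>cball 0 k. deriv f z = 0}} \<inter>
     E_top \<rho> p interior_of {f. cball 0 k \<subseteq> range f} \<inter>
     E_top \<rho> p interior_of {f. \<exists>z. norm z > k \<and> deriv f z = 0}"

lemma openin_typical_on_disc: "openin (E_top \<rho> p) (typical_on_disc k)"
  unfolding typical_on_disc_def by (intro openin_Int openin_interior_of)

lemma typical_on_disc_meets_open:
  assumes U: "openin (E_top \<rho> p) U" "U \<noteq> {}"
  shows "typical_on_disc k \<inter> U \<noteq> {}"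
proof -
  let ?N = "E_top \<rho> p interior_of {f. \<forall>z\<in>cball 0 k. deriv f z = 0 \<longrightarrow> deriv (deriv f) z \<noteq> 0}"
  let ?I = "E_top \<rho> p interior_of {f. inj_on f {z\<in>cball 0 k. deriv f z = 0}}"
  let ?S = "E_top \<rho> p interior_of {f. cball 0 k \<subseteq> range f}"
  let ?C = "E_top \<rho> p interior_of {f. \<exists>z. norm z > k \<and> deriv f z = 0}"
  have UE: "f \<in> E_space \<rho> p" if "f \<in> U" for f
    using openin_subset[OF U(1)] that by (auto simp: topspace_E_top)
  obtain f where f: "f \<in> U" "\<forall>z\<in>cball 0 k. deriv f z = 0 \<longrightarrow> deriv (deriv f) z \<noteq> 0"
      "inj_on f {z\<in>cball 0 k. deriv f z = 0}"
    using ex_morse_in_open[OF U] by blast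
  have "f \<in> ?N" using nondegenerate_interior[OF UE[OF f(1)] f(2)] .
  moreover have "f \<in> ?I"
  proof (rule in_interior_sequentially[OF UE[OF f(1)]])
    fix g :: "nat \<Rightarrow> complex \<Rightarrow> complex"
    assume "\<And>j. g j \<in> E_space \<rho> p" and lim: "\<And>R. uniform_limit (cball 0 R) g f sequentially"
    then show "\<exists>j. g j \<in> {f. inj_on f {z\<in>cball 0 k. deriv f z = 0}}"
      using critical_values_inj_stable[OF _ E_space_holo[OF UE[OF f(1)]] lim f(2,3)]
      by (simp add: E_space_holo)
  qed
  ultimately have ne1: "U \<inter> ?N \<inter> ?I \<noteq> {}" using f(1) by blast
  have op1: "openin (E_top \<rho> p) (U \<inter> ?N \<inter> ?I)" by (intro openin_Int U(1) openin_interior_of)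
  \<comment> \<open>The polynomial replaces \<open>f\<close>; nondegeneracy and injectivity carry
    over merely because \<open>?N\<close> and \<open>?I\<close> are open.\<close>
  obtain P where P: "degree P > 0" "poly P \<in> U \<inter> ?N \<inter> ?I"
    using ex_nonconstant_poly_in_open[OF op1 ne1] by blast
  have "poly P \<in> ?S"
  proof (rule in_interior_sequentially[OF poly_in_E_space])
    fix g :: "nat \<Rightarrow> complex \<Rightarrow> complex"
    assume "\<And>j. g j \<in> E_space \<rho> p" and lim: "\<And>R. uniform_limit (cball 0 R) g (poly P) sequentially"
    then show "\<exists>j. g j \<in> {f. cball 0 k \<subseteq> range f}"
      using covers_cball_stable[OF _ E_space_holo[OF poly_in_E_space] lim surj_poly[OF P(1)]]
      by (simp add: E_space_holo)
  qed
  with P(2) have ne2: "U \<inter> ?N \<inter> ?I \<inter> ?S \<noteq> {}" by blast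
  have op2: "openin (E_top \<rho> p) (U \<inter> ?N \<inter> ?I \<inter> ?S)" by (intro openin_Int U(1) openin_interior_of)
  obtain Q w where Q: "poly Q \<in> U \<inter> ?N \<inter> ?I \<inter> ?S" "degree (pderiv Q) > 0"
      "poly (pderiv Q) w = 0" "norm w > k"
    using ex_far_critical_poly_in_open[OF op2 ne2] by blast
  have "poly Q \<in> ?C"
  proof (rule in_interior_sequentially[OF poly_in_E_space])
    fix g :: "nat \<Rightarrow> complex \<Rightarrow> complex"
    assume gE: "\<And>j. g j \<in> E_space \<rho> p" and lim: "\<And>R. uniform_limit (cball 0 R) g (poly Q) sequentially"
    have "\<exists>j z. norm z > k \<and> deriv (g j) z = 0"
      by (rule far_critical_point_stable[OF E_space_holo[OF gE] E_space_holo[OF poly_in_E_space] lim])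
        (use Q not_constant_poly[OF Q(2)] in \<open>auto simp: deriv_poly\<close>)
    then show "\<exists>j. g j \<in> {f. \<exists>z. norm z > k \<and> deriv f z = 0}" by simp
  qed
  with Q(1) show ?thesis by (auto simp: typical_on_disc_def)
qed

text \<open>A failure of nondegeneracy, injectivity or surjectivity involves at most two critical
  points or one missed value, so it shows in a large enough disc; and a set with points beyond every
  disc is infinite.\<close>

lemma typical_if_typical_on_discs:
  assumes "\<And>k::nat. f \<in> typical_on_disc (real k)"
  shows "f \<in> E_space \<rho> p \<and> typical f"
proof -
  have f: "f \<in> E_space \<rho> p"
    using openin_subset[OF openin_typical_on_disc] assms by (auto simp: topspace_E_top)
  have mem: "\<forall>z\<in>cball 0 (real k). deriv f z = 0 \<longrightarrow> deriv (deriv f) z \<noteq> 0"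
    "inj_on f {z\<in>cball 0 (real k). deriv f z = 0}" "cball 0 (real k) \<subseteq> range f"
    "\<exists>z. norm z > real k \<and> deriv f z = 0" for k
  proof -
    have "f \<in> {f. \<forall>z\<in>cball 0 (real k). deriv f z = 0 \<longrightarrow> deriv (deriv f) z \<noteq> 0} \<inter>
        {f. inj_on f {z\<in>cball 0 (real k). deriv f z = 0}} \<inter> {f. cball 0 (real k) \<subseteq> range f} \<inter>
        {f. \<exists>z. norm z > real k \<and> deriv f z = 0}"
      using assms[of k] unfolding typical_on_disc_def
      by (rule rev_subsetD) (intro Int_mono interior_of_subset)
    then show "\<forall>z\<in>cball 0 (real k). deriv f z = 0 \<longrightarrow> deriv (deriv f) z \<noteq> 0"
      "inj_on f {z\<in>cball 0 (real k). deriv f z = 0}" "cball 0 (real k) \<subseteq> range f"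
      "\<exists>z. norm z > real k \<and> deriv f z = 0"
      unfolding Int_iff mem_Collect_eq by blast+
  qed
  have big: "\<exists>k. z \<in> cball 0 (real k)" for z :: complex
    using real_arch_simple[of "norm z"] by simp
  have "surj f" using mem(3) big by blast
  moreover have "infinite (critical_points f)"
  proof
    assume "finite (critical_points f)"
    then obtain B where B: "\<And>z. z \<in> critical_points f \<Longrightarrow> norm z \<le> B"
      using finite_imp_bounded by (metis bounded_iff)
    obtain k where "B \<le> real k" using real_arch_simple by blast
    then show False using mem(4)[of k] B by (force simp: critical_points_def)
  qed
  moreover have "\<forall>z\<in>critical_points f. deriv (deriv f) z \<noteq> 0"
    using mem(1) big by (auto simp only: critical_points_def mem_Collect_eq) blast
  moreover have "inj_on f (critical_points f)"
  proof (rule inj_onI)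
    fix a b assume ab: "a \<in> critical_points f" "b \<in> critical_points f" "f a = f b"
    obtain k where "max (norm a) (norm b) \<le> real k" using real_arch_simple by blast
    then show "a = b" using ab inj_onD[OF mem(2)[of k], of a b] by (simp add: critical_points_def)
  qed
  ultimately show ?thesis using f by (simp add: typical_def E_space_holo)
qed

end

theorem theorem3p4:
  fixes \<rho> :: nat and p :: real
  assumes "\<rho> \<ge> 1" and "p > 0"
  shows "\<exists>G. G \<subseteq> {f \<in> E_space \<rho> p. typical f} \<and>
             gdelta_in (E_top \<rho> p) G \<and>
             (E_top \<rho> p) closure_of G = E_space \<rho> p"
proof -
  interpret typical_growth \<rho> p using assms by unfold_locales
  let ?W = "\<lambda>k::nat. typical_on_disc (real k)"
  have "E_top \<rho> p closure_of ?W k = E_space \<rho> p" for k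
    using typical_on_disc_meets_open dense_intersects_open[of "E_top \<rho> p" "?W k"]
    by (auto simp: topspace_E_top)
  then have "E_top \<rho> p closure_of (\<Inter>k. ?W k) = E_space \<rho> p"
    by (intro Baire_E_top openin_typical_on_disc)
  moreover have "gdelta_in (E_top \<rho> p) (\<Inter>k. ?W k)"
    by (rule gdelta_in_Inter) (auto intro: open_imp_gdelta_in openin_typical_on_disc)
  moreover have "(\<Inter>k. ?W k) \<subseteq> {f \<in> E_space \<rho> p. typical f}"
    using typical_if_typical_on_discs by blast
  ultimately show ?thesis by blast
qed

end
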